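(* Let $X$ be a strictly convex real Banach space such that $\dim(X)\geq 2$ and such that the set $Sm(X)$ of smooth points of $X$ is norm dense in $S_X$, and let $K$ be a totally disconnected locally compact Hausdorff space with $|K|\geq 2$. Then $C_0(K,X)$ satisfies the Mazur--Ulam property.
   Context: All Banach spaces are real. $C_0(K,X)$ is the Banach space of continuous functions $f:K\to X$ vanishing at infinity (for every $\varepsilon>0$ there is a compact $K_\varepsilon\subseteq K$ with $\|f(t)\|<\varepsilon$ off $K_\varepsilon$), with the sup norm. A Banach space is strictly convex if every point of its unit sphere is an extreme point of its closed unit ball. A point $x\in S_X$ is a smooth point if there is a unique $f\in S_{X^*}$ with $f(x)=1$. A Banach space $Z$ satisfies the Mazur--Ulam property if for every Banach space $Y$, every surjective isometry $\Delta:S_Z\to S_Y$ between the unit spheres admits an extension to a surjective real-linear isometry from $Z$ onto $Y$. *)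

theory Defs
  imports "HOL-Analysis.Analysis"
begin

definition strictly_convex_space :: "'x::real_normed_vector itself \<Rightarrow> bool" where
  "strictly_convex_space _ \<longleftrightarrow>
     (\<forall>x::'x \<in> sphere 0 1. x extreme_point_of (cball 0 1))"

definition smooth_points :: "'x::real_normed_vector set" where
  "smooth_points = {x \<in> sphere 0 1.
     \<exists>!f::'x \<Rightarrow> real. bounded_linear f \<and> onorm f = 1 \<and> f x = 1}"

definition totally_disconnected_space :: "'k::topological_space itself \<Rightarrow> bool" where
  "totally_disconnected_space _ \<longleftrightarrow>
     (\<forall>S::'k set. connected S \<longrightarrow> (\<exists>a. S \<subseteq> {a}))"

definition C0 :: "('k::topological_space \<Rightarrow> 'x::real_normed_vector) set" where
  "C0 = {f. continuous_on UNIV f \<and>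
          (\<forall>e>0. \<exists>C. compact C \<and> (\<forall>t. t \<notin> C \<longrightarrow> norm (f t) < e))}"

definition supnorm :: "('k \<Rightarrow> 'x::real_normed_vector) \<Rightarrow> real" where
  "supnorm f = (SUP t. norm (f t))"

definition C0_sphere :: "('k::topological_space \<Rightarrow> 'x::real_normed_vector) set" where
  "C0_sphere = {f \<in> C0. supnorm f = 1}"

text \<open>Mazur--Ulam property of C_0(K,X), with respect to a Banach space Y given as a type.
  Quantification over all Banach spaces Y is obtained by leaving 'y free in the theorem.\<close>
definition C0_MUP_wrt ::
  "'k::topological_space itself \<Rightarrow> 'x::real_normed_vector itself \<Rightarrow> 'y::banach itself \<Rightarrow> bool" where
  "C0_MUP_wrt _ _ _ \<longleftrightarrow>
    (\<forall>\<Delta> :: ('k \<Rightarrow> 'x) \<Rightarrow> 'y.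
       (\<forall>f\<in>C0_sphere. \<forall>g\<in>C0_sphere. norm (\<Delta> f - \<Delta> g) = supnorm (\<lambda>t. f t - g t)) \<and>
       \<Delta> ` C0_sphere = sphere 0 1
       \<longrightarrow>
       (\<exists>T :: ('k \<Rightarrow> 'x) \<Rightarrow> 'y.
          (\<forall>f\<in>C0. \<forall>g\<in>C0. T (\<lambda>t. f t + g t) = T f + T g) \<and>
          (\<forall>c. \<forall>f\<in>C0. T (\<lambda>t. c *\<^sub>R f t) = c *\<^sub>R T f) \<and>
          (\<forall>f\<in>C0. \<forall>g\<in>C0. norm (T f - T g) = supnorm (\<lambda>t. f t - g t)) \<and>
          T ` C0 = UNIV \<and>
          (\<forall>f\<in>C0_sphere. T f = \<Delta> f)))"

end

theory Submission
  imports Defs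
begin

text \<open>Let \<open>T\<close> be a surjective isometry from the unit sphere of $C_0(K,X)$ onto that of $Y$.
  By strict convexity the maximal faces of the domain are the sets
  $A(t,x) = \{f : f(t) = x\}$ with $\|x\| = 1$. A norm-one function that equals $x$ on a small
  clopen set and is smaller elsewhere can only span a segment of the sphere with functions taking
  the value $x$ somewhere in that set; as $T$ preserves the relation $\|f + g\| = 2$, the images of the
  faces are convex, and $T$ maps $A(t,-x)$ to $-T(A(t,x))$. Hahn--Banach gives a functional
  $\psi$ of norm at most one that equals 1 on $T(A(t,x))$ and $-1$ on $T(A(t,-x))$, whence
  $1 - \|m - x\| \le \psi(T f) \le \|m + x\| - 1$ if $f = m$ near $t$. If moreover $f$ has norm one at
  some $s \ne t$, the midpoint of $T f$ and $T e$, where $e$ is $f$ changed to 0 near $t$, is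
  $T k$ with $k = m/2$ near $t$, again by strict convexity. Iterating the halving turns the bounds
  into one-sided derivatives of the norm, so $\psi(T f) = \varphi_x(f(t))$ when $x$ is smooth with
  support functional $\varphi_x$. This formula shows that $T$ is affine on every face, which
  removes the restriction on $f$. As smooth points are dense, the functionals $\varphi_x$ separate points, and
  the homogeneous extension of $T$ is linear.\<close>

section \<open>Sublinear functionals and the Hahn--Banach theorem\<close>

definition sublinear :: "('a::real_vector \<Rightarrow> real) \<Rightarrow> bool" where
  "sublinear p \<longleftrightarrow> (\<forall>x y. p (x + y) \<le> p x + p y) \<and> (\<forall>c\<ge>0. \<forall>x. p (c *\<^sub>R x) = c * p x)"

lemma sublinear_add: "sublinear p \<Longrightarrow> p (x + y) \<le> p x + p y"
  and sublinear_scaleR: "sublinear p \<Longrightarrow> c \<ge> 0 \<Longrightarrow> p (c *\<^sub>R x) = c * p x"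
  by (auto simp: sublinear_def)

lemma sublinear_0: "sublinear p \<Longrightarrow> p 0 = 0"
  using sublinear_scaleR[of p 0 0] by simp

lemma sublinear_minus: "sublinear p \<Longrightarrow> - p (- x) \<le> p x"
  using sublinear_add[of p x "- x"] sublinear_0[of p] by simp

lemma sublinear_norm: "sublinear norm"
  by (simp add: sublinear_def norm_triangle_ineq)

text \<open>One inequality is enough for homogeneity: applied to \<open>inverse c\<close> it gives
  the reverse one. For infima only this half is immediate.\<close>

lemma sublinearI:
  assumes add: "\<And>x y. p (x + y) \<le> p x + p y" and zero: "p 0 = 0"
    and scale: "\<And>c x. c > 0 \<Longrightarrow> p (c *\<^sub>R x) \<le> c * p x"
  shows "sublinear p"
proof -
  have "p (c *\<^sub>R x) = c * p x" if "c \<ge> 0" for c x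
  proof (cases "c = 0")
    case False
    with that have c: "c > 0" by simp
    have "p x \<le> inverse c * p (c *\<^sub>R x)"
      using scale[of "inverse c" "c *\<^sub>R x"] c by simp
    then have "c * p x \<le> p (c *\<^sub>R x)"
      using c by (simp add: field_simps)
    with scale[OF c, of x] show ?thesis by simp
  qed (simp add: zero)
  with add show ?thesis by (simp add: sublinear_def)
qed

lemma le_cINF_add:
  fixes f :: "'a \<Rightarrow> real" and g :: "'b \<Rightarrow> real"
  assumes "I \<noteq> {}" "J \<noteq> {}" and le: "\<And>i j. i \<in> I \<Longrightarrow> j \<in> J \<Longrightarrow> a \<le> f i + g j"
  shows "a \<le> (INF i\<in>I. f i) + (INF j\<in>J. g j)"
proof -
  have "a - f i \<le> (INF j\<in>J. g j)" if "i \<in> I" for i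
    using le[OF that] assms(2) by (intro cINF_greatest) (auto simp: algebra_simps)
  then have "a - (INF j\<in>J. g j) \<le> (INF i\<in>I. f i)"
    using assms(1) by (intro cINF_greatest) (auto simp: algebra_simps)
  then show ?thesis by simp
qed

text \<open>A convex cone on which \<open>p\<close> can itself prescribe the values of a linear
  functional; positive homogeneity is left to the sublinearity of \<open>p\<close>.\<close>

definition additive_cone :: "('a::real_vector \<Rightarrow> real) \<Rightarrow> 'a set \<Rightarrow> bool" where
  "additive_cone p M \<longleftrightarrow> 0 \<in> M \<and> (\<forall>m\<in>M. \<forall>n\<in>M. m + n \<in> M \<and> p (m + n) = p m + p n) \<and>
     (\<forall>c\<ge>0. \<forall>m\<in>M. c *\<^sub>R m \<in> M)"

text \<open>For the norm and a ray, this is the one-sided derivative of the norm in the direction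
  of the ray.\<close>

definition tangent :: "('a::real_vector \<Rightarrow> real) \<Rightarrow> 'a set \<Rightarrow> 'a \<Rightarrow> real" where
  "tangent p M y = (INF m\<in>M. p (y + m) - p m)"

lemma additive_cone_ray:
  assumes "sublinear p"
  shows "additive_cone p {c *\<^sub>R v |c. c \<ge> 0}"
  unfolding additive_cone_def
proof (intro conjI ballI allI impI)
  show "0 \<in> {c *\<^sub>R v |c. c \<ge> 0}" by (auto intro!: exI[of _ 0])
next
  fix m n assume "m \<in> {c *\<^sub>R v |c. c \<ge> 0}" "n \<in> {c *\<^sub>R v |c. c \<ge> 0}"
  then obtain a b where ab: "m = a *\<^sub>R v" "n = b *\<^sub>R v" "a \<ge> 0" "b \<ge> 0" by blast
  then have mn: "m + n = (a + b) *\<^sub>R v" by (simp add: scaleR_left_distrib)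
  then show "m + n \<in> {c *\<^sub>R v |c. c \<ge> 0}" using ab by (auto intro!: exI[of _ "a + b"])
  show "p (m + n) = p m + p n"
    unfolding mn using ab assms by (simp add: sublinear_scaleR distrib_right)
next
  fix c :: real and m assume "c \<ge> 0" "m \<in> {c *\<^sub>R v |c. c \<ge> 0}"
  then obtain a where "m = a *\<^sub>R v" "a \<ge> 0" by blast
  with \<open>c \<ge> 0\<close> have "c *\<^sub>R m = (c * a) *\<^sub>R v \<and> c * a \<ge> 0" by simp
  then show "c *\<^sub>R m \<in> {c *\<^sub>R v |c. c \<ge> 0}" by blast
qed

context
  fixes p :: "'a::real_vector \<Rightarrow> real" and M
  assumes p: "sublinear p" and M: "additive_cone p M"
begin

lemma tangent_bdd_below: "bdd_below ((\<lambda>m. p (y + m) - p m) ` M)"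
proof (rule bdd_belowI2)
  fix m
  show "- p (- y) \<le> p (y + m) - p m"
    using sublinear_add[OF p, of "y + m" "- y"] by simp
qed

lemma tangent_le: "m \<in> M \<Longrightarrow> tangent p M y \<le> p (y + m) - p m"
  unfolding tangent_def by (rule cINF_lower[OF tangent_bdd_below])

lemma tangent_le_self: "tangent p M y \<le> p y"
  using tangent_le[of 0 y] M sublinear_0[OF p] by (simp add: additive_cone_def)

lemma tangent_minus_le: "m \<in> M \<Longrightarrow> tangent p M (- m) \<le> - p m"
  using tangent_le[of m "- m"] sublinear_0[OF p] by simp

text \<open>If \<open>m\<close> competes for \<open>x\<close> and \<open>n\<close> for
  \<open>y\<close>, then \<open>m + n\<close> competes for \<open>x + y\<close>, and additivity on
  the cone splits \<open>p (m + n)\<close>. Scaling competitors by \<open>c\<close> gives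
  homogeneity.\<close>

lemma sublinear_tangent: "sublinear (tangent p M)"
proof (rule sublinearI)
  have ne: "M \<noteq> {}" using M by (auto simp: additive_cone_def)
  show "tangent p M (x + y) \<le> tangent p M x + tangent p M y" for x y
    unfolding tangent_def[of p M x] tangent_def[of p M y]
  proof (intro le_cINF_add ne)
    fix m n assume "m \<in> M" "n \<in> M"
    then have mn: "m + n \<in> M" "p (m + n) = p m + p n" using M by (auto simp: additive_cone_def)
    have "tangent p M (x + y) \<le> p ((x + m) + (y + n)) - p (m + n)"
      using tangent_le[OF mn(1), of "x + y"] by (simp add: algebra_simps)
    also have "\<dots> \<le> (p (x + m) - p m) + (p (y + n) - p n)"
      using sublinear_add[OF p, of "x + m" "y + n"] mn(2) by simp
    finally show "tangent p M (x + y) \<le> (p (x + m) - p m) + (p (y + n) - p n)" .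
  qed
  have "0 \<le> tangent p M 0"
    unfolding tangent_def using ne by (intro cINF_greatest) auto
  then show "tangent p M 0 = 0"
    using tangent_le_self[of 0] sublinear_0[OF p] by simp
  show "tangent p M (c *\<^sub>R x) \<le> c * tangent p M x" if c: "c > 0" for c x
  proof -
    have "tangent p M (c *\<^sub>R x) / c \<le> tangent p M x"
      unfolding tangent_def[of p M x]
    proof (intro cINF_greatest ne)
      fix m assume "m \<in> M"
      then have "c *\<^sub>R m \<in> M" using M c by (auto simp: additive_cone_def)
      then have "tangent p M (c *\<^sub>R x) \<le> p (c *\<^sub>R (x + m)) - p (c *\<^sub>R m)"
        using tangent_le[of "c *\<^sub>R m" "c *\<^sub>R x"] by (simp add: algebra_simps)
      also have "\<dots> = c * (p (x + m) - p m)"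
        using c by (simp only: sublinear_scaleR[OF p] less_imp_le right_diff_distrib)
      finally show "tangent p M (c *\<^sub>R x) / c \<le> p (x + m) - p m"
        using c by (simp add: field_simps)
    qed
    then show ?thesis using c by (simp add: field_simps)
  qed
qed

end

text \<open>Supplies the lower bounds for Zorn's lemma. The common majorant \<open>q\<close> keeps
  the infimum finite through \<open>- q (- x) \<le> p x\<close>; for subadditivity the smaller of
  two members of the chain serves both arguments.\<close>

lemma sublinear_chain_Inf:
  assumes C: "C \<noteq> {}" "\<And>p. p \<in> C \<Longrightarrow> sublinear p"
    and chain: "\<And>p r. p \<in> C \<Longrightarrow> r \<in> C \<Longrightarrow> p \<le> r \<or> r \<le> p"
    and bound: "\<And>p. p \<in> C \<Longrightarrow> p \<le> q"
  shows "sublinear (\<lambda>x. INF p\<in>C. p x)" and "p \<in> C \<Longrightarrow> (INF p\<in>C. p x) \<le> p x"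
proof -
  have bdd: "bdd_below ((\<lambda>p. p x) ` C)" for x
  proof (rule bdd_belowI2)
    fix p assume "p \<in> C"
    then show "- q (- x) \<le> p x"
      using sublinear_minus[OF C(2), of p x] le_funD[OF bound, of p "- x"] by simp
  qed
  then show low: "(INF p\<in>C. p x) \<le> p x" if "p \<in> C" for p x
    using that by (rule cINF_lower)
  show "sublinear (\<lambda>x. INF p\<in>C. p x)"
  proof (rule sublinearI)
    show "(INF p\<in>C. p (x + y)) \<le> (INF p\<in>C. p x) + (INF p\<in>C. p y)" for x y
    proof (intro le_cINF_add C(1))
      fix p r assume pr: "p \<in> C" "r \<in> C"
      from chain[OF this] show "(INF p\<in>C. p (x + y)) \<le> p x + r y"
      proof
        assume "p \<le> r"
        then show ?thesis
          using low[OF pr(1), of "x + y"] sublinear_add[OF C(2)[OF pr(1)], of x y]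
          by (smt (verit) le_funD)
      next
        assume "r \<le> p"
        then show ?thesis
          using low[OF pr(2), of "x + y"] sublinear_add[OF C(2)[OF pr(2)], of x y]
          by (smt (verit) le_funD)
      qed
    qed
    show "(INF p\<in>C. p 0) = 0"
      using C by (simp add: sublinear_0 cong: INF_cong_simp)
    show "(INF p\<in>C. p (c *\<^sub>R x)) \<le> c * (INF p\<in>C. p x)" if c: "c > 0" for c x
    proof -
      have "(INF p\<in>C. p (c *\<^sub>R x)) / c \<le> (INF p\<in>C. p x)"
      proof (intro cINF_greatest C(1))
        fix p assume "p \<in> C"
        then show "(INF p\<in>C. p (c *\<^sub>R x)) / c \<le> p x"
          using low[of p "c *\<^sub>R x"] sublinear_scaleR[OF C(2), of p c x] c by (simp add: field_simps)
      qed
      then show ?thesis using c by (simp add: field_simps)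
    qed
  qed
qed

text \<open>A minimal sublinear functional is linear: it coincides with its tangent functional along
  every ray, hence is odd.\<close>

theorem Hahn_Banach_sublinear:
  fixes q :: "'a::real_vector \<Rightarrow> real"
  assumes q: "sublinear q"
  obtains \<psi> where "linear \<psi>" "\<And>x. \<psi> x \<le> q x"
proof -
  define A where "A = {p. sublinear p \<and> p \<le> q}"
  have "\<exists>p\<in>A. \<forall>r\<in>A. p \<ge> r \<longrightarrow> r = p"
  proof (rule predicate_Zorn)
    show "partial_order_on A (relation_of (\<ge>) A)"
      by (rule partial_order_on_relation_ofI) auto
    fix C assume "C \<in> Chains (relation_of (\<ge>) A)"
    then have sub: "C \<subseteq> A" and chain: "\<And>p r. p \<in> C \<Longrightarrow> r \<in> C \<Longrightarrow> p \<le> r \<or> r \<le> p"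
      by (auto simp: Chains_def relation_of_def)
    show "\<exists>u\<in>A. \<forall>a\<in>C. a \<ge> u"
    proof (cases "C = {}")
      case True
      then show ?thesis using q by (auto simp: A_def)
    next
      case False
      have C: "\<And>p. p \<in> C \<Longrightarrow> sublinear p" "\<And>p. p \<in> C \<Longrightarrow> p \<le> q" using sub by (auto simp: A_def)
      let ?u = "\<lambda>x. INF p\<in>C. p x"
      have low: "?u \<le> p" if "p \<in> C" for p
        using sublinear_chain_Inf(2)[OF False C(1) chain C(2) that] by (simp add: le_fun_def)
      moreover have "?u \<in> A"
        using sublinear_chain_Inf(1)[OF False C(1) chain C(2)] low False C(2)
        unfolding A_def by (blast intro: order_trans)
      ultimately show ?thesis by blast
    qed
  qed
  then obtain p where p: "sublinear p" "p \<le> q" and min: "\<And>r. sublinear r \<Longrightarrow> r \<le> p \<Longrightarrow> r = p"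
    unfolding A_def by (blast intro: order_trans)
  have odd: "p (- v) = - p v" for v
  proof -
    let ?M = "{c *\<^sub>R v |c. c \<ge> 0}"
    note cone = p(1) additive_cone_ray[OF p(1), of v]
    have eq: "tangent p ?M = p"
      by (intro min sublinear_tangent[OF cone] le_funI tangent_le_self[OF cone])
    have "v \<in> ?M" by (auto intro!: exI[of _ 1])
    from tangent_minus_le[OF cone this] have "p (- v) \<le> - p v"
      unfolding eq .
    then show ?thesis using sublinear_minus[OF p(1), of v] by simp
  qed
  have "linear p"
  proof (rule linearI)
    show "p (x + y) = p x + p y" for x y
      using sublinear_add[OF p(1), of x y] sublinear_add[OF p(1), of "- x" "- y"] odd[of "x + y"]
        odd[of x] odd[of y] by simp
    show "p (c *\<^sub>R x) = c *\<^sub>R p x" for c x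
      using sublinear_scaleR[OF p(1), of c x] sublinear_scaleR[OF p(1), of "- c" x] odd[of "c *\<^sub>R x"]
      by (cases "c \<ge> 0") auto
  qed
  with p(2) that show ?thesis by (auto simp: le_fun_def)
qed

text \<open>Any linear functional below the tangent functional works: the latter is at most
  \<open>p\<close>, and at \<open>- m\<close> it is at most \<open>- p m\<close>, which forces
  equality on the cone.\<close>

corollary Hahn_Banach_cone:
  assumes p: "sublinear p" and M: "additive_cone p M"
  obtains \<psi> where "linear \<psi>" "\<And>x. \<psi> x \<le> p x" "\<And>m. m \<in> M \<Longrightarrow> \<psi> m = p m"
proof -
  obtain \<psi> where \<psi>: "linear \<psi>" "\<And>x. \<psi> x \<le> tangent p M x"
    using Hahn_Banach_sublinear[OF sublinear_tangent[OF p M]] by blast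
  have le: "\<psi> x \<le> p x" for x
    using \<psi>(2)[of x] tangent_le_self[OF p M, of x] by simp
  have "\<psi> m = p m" if "m \<in> M" for m
    using tangent_minus_le[OF p M that] \<psi>(2)[of "- m"] linear_neg[OF \<psi>(1), of m] le[of m] by simp
  with that \<psi>(1) le show ?thesis by blast
qed

text \<open>The norm is additive on the cone spanned by \<open>F\<close>: a sum of two of its
  elements is a multiple of a convex combination of points of \<open>F\<close>, again of norm
  one.\<close>

lemma support_functional_convex:
  fixes F :: "'a::real_normed_vector set"
  assumes F: "convex F" "F \<subseteq> sphere 0 1" "F \<noteq> {}"
  obtains \<psi> :: "'a \<Rightarrow> real"
    where "linear \<psi>" "\<And>y. \<psi> y \<le> norm y" "\<And>y. y \<in> F \<Longrightarrow> \<psi> y = 1"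
proof -
  let ?M = "{c *\<^sub>R y |c y. c \<ge> 0 \<and> y \<in> F}"
  have norm_F: "norm (c *\<^sub>R y) = c" if "c \<ge> 0" "y \<in> F" for c y
    using that F(2) by auto
  have "additive_cone norm ?M"
    unfolding additive_cone_def
  proof (intro conjI ballI allI impI)
    obtain y where "y \<in> F" using F(3) by blast
    then have "0 = 0 *\<^sub>R y \<and> (0::real) \<ge> 0 \<and> y \<in> F" by simp
    then show "0 \<in> ?M" by blast
  next
    fix m n assume "m \<in> ?M" "n \<in> ?M"
    then obtain a b y z where mn: "m = a *\<^sub>R y" "n = b *\<^sub>R z" and ab: "a \<ge> 0" "b \<ge> 0"
      and yz: "y \<in> F" "z \<in> F" by blast
    have "\<exists>w\<in>F. m + n = (a + b) *\<^sub>R w"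
    proof (cases "a + b = 0")
      case True
      then have "a = 0" "b = 0" using ab by auto
      then show ?thesis using yz mn by auto
    next
      case False
      let ?w = "(a / (a + b)) *\<^sub>R y + (b / (a + b)) *\<^sub>R z"
      have "a / (a + b) + b / (a + b) = 1" using False by (simp flip: add_divide_distrib)
      then have "?w \<in> F"
        using convexD[OF F(1) yz, of "a / (a + b)" "b / (a + b)"] ab by simp
      moreover have "m + n = (a + b) *\<^sub>R ?w" using False mn by (simp add: scaleR_add_right)
      ultimately show ?thesis by blast
    qed
    then obtain w where w: "w \<in> F" "m + n = (a + b) *\<^sub>R w" by blast
    then have "m + n = (a + b) *\<^sub>R w \<and> a + b \<ge> 0 \<and> w \<in> F" using ab by simp
    then show "m + n \<in> ?M" by blast
    have "norm ((a + b) *\<^sub>R w) = a + b" using ab w(1) by (intro norm_F) auto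
    then show "norm (m + n) = norm m + norm n"
      unfolding w(2) unfolding mn using norm_F[OF ab(1) yz(1)] norm_F[OF ab(2) yz(2)] by simp
  next
    fix c :: real and m assume "c \<ge> 0" "m \<in> ?M"
    then obtain a y where "m = a *\<^sub>R y" "a \<ge> 0" "y \<in> F" by blast
    with \<open>c \<ge> 0\<close> have "c *\<^sub>R m = (c * a) *\<^sub>R y \<and> c * a \<ge> 0 \<and> y \<in> F" by simp
    then show "c *\<^sub>R m \<in> ?M" by blast
  qed
  then obtain \<psi> where \<psi>: "linear \<psi>" "\<And>x. \<psi> x \<le> norm x" "\<And>m. m \<in> ?M \<Longrightarrow> \<psi> m = norm m"
    using Hahn_Banach_cone[OF sublinear_norm] by blast
  have "\<psi> y = 1" if "y \<in> F" for y
  proof -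
    have "y = 1 *\<^sub>R y \<and> (1::real) \<ge> 0 \<and> y \<in> F" using that by simp
    then have "y \<in> ?M" by blast
    then show ?thesis using \<psi>(3)[of y] F(2) that by auto
  qed
  with \<psi>(1,2) that show ?thesis by blast
qed

lemma linear_le_norm_abs:
  assumes "linear \<psi>" "\<And>y. \<psi> y \<le> norm y"
  shows "\<bar>\<psi> y\<bar> \<le> norm y"
  using assms(2)[of y] assms(2)[of "- y"] linear_neg[OF assms(1), of y] by simp

section \<open>Smooth points and the derivative of the norm\<close>

text \<open>The last clause says that \<open>\<phi>\<close> dominates, hence is, the one-sided
  derivative of the norm at \<open>x\<close>, the limit of the decreasing function
  \<open>\<lambda>l. norm (v + l *\<^sub>R x) - l\<close>.\<close>

definition norm_gradient :: "'x::real_normed_vector \<Rightarrow> ('x \<Rightarrow> real) \<Rightarrow> bool" where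
  "norm_gradient x \<phi> \<longleftrightarrow> linear \<phi> \<and> \<phi> x = 1 \<and> (\<forall>v. \<phi> v \<le> norm v) \<and>
     (\<forall>v c. (\<forall>l\<ge>0. c \<le> norm (v + l *\<^sub>R x) - l) \<longrightarrow> c \<le> \<phi> v)"

text \<open>For each \<open>v\<close>, Hahn--Banach below the tangent functional at \<open>x\<close>
  gives a support functional at \<open>x\<close> agreeing with it at \<open>v\<close>. Smoothness
  makes all of these the same, so the tangent functional is itself linear.\<close>

lemma smooth_point_norm_gradient:
  assumes x: "x \<in> smooth_points"
  obtains \<phi> where "norm_gradient x \<phi>"
proof -
  have nx: "norm x = 1" using x by (simp add: smooth_points_def)
  have dual: "bounded_linear f \<and> onorm f = 1 \<and> f x = 1"
    if f: "linear f" "\<And>v. f v \<le> norm v" "f x = 1" for f :: "'a \<Rightarrow> real"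
  proof -
    have b: "norm (f v) \<le> 1 * norm v" for v using linear_le_norm_abs[OF f(1,2)] by simp
    then have bl: "bounded_linear f"
      using f(1) by (intro bounded_linear_intro[of f 1]) (auto simp: linear_add linear_scale)
    moreover have "onorm f \<le> 1" using onorm_bound[of 1 f] b by simp
    moreover have "1 \<le> onorm f" using onorm[OF bl, of x] f(3) nx by simp
    ultimately show ?thesis using f(3) by simp
  qed
  let ?ray = "\<lambda>v. {c *\<^sub>R v |c. c \<ge> 0}"
  let ?q = "tangent norm (?ray x)"
  note cone = sublinear_norm additive_cone_ray[OF sublinear_norm, of x]
  have ray: "v \<in> ?ray v" for v :: 'a by (auto intro!: exI[of _ 1])
  have q_sub: "sublinear ?q" by (rule sublinear_tangent[OF cone])
  have ex: "\<exists>f. linear f \<and> (\<forall>y. f y \<le> norm y) \<and> f x = 1 \<and> f v = ?q v" for v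
  proof -
    obtain f where f: "linear f" "\<And>y. f y \<le> ?q y" "\<And>m. m \<in> ?ray v \<Longrightarrow> f m = ?q m"
      using Hahn_Banach_cone[OF q_sub additive_cone_ray[OF q_sub, of v]] by blast
    have le: "f y \<le> norm y" for y using f(2)[of y] tangent_le_self[OF cone, of y] by simp
    \<comment> \<open>The tangent functional is at most -1 at \<open>- x\<close>, whence
      \<open>f x \<ge> 1\<close>.\<close>
    have "f x = 1"
      using f(2)[of "- x"] tangent_minus_le[OF cone ray] linear_neg[OF f(1), of x] le[of x] nx by simp
    with f(1) le f(3)[OF ray] show ?thesis by blast
  qed
  obtain \<phi> where \<phi>: "linear \<phi>" "\<And>y. \<phi> y \<le> norm y" "\<phi> x = 1" using ex by blast
  have "\<phi> v = ?q v" for v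
  proof -
    obtain f where f: "linear f" "\<And>y. f y \<le> norm y" "f x = 1" "f v = ?q v" using ex by blast
    have "f = \<phi>"
      using x dual[OF f(1-3)] dual[OF \<phi>] unfolding smooth_points_def by auto
    with f(4) show ?thesis by simp
  qed
  moreover have "c \<le> ?q v" if "\<forall>l\<ge>0. c \<le> norm (v + l *\<^sub>R x) - l" for c v
    unfolding tangent_def using that ray[of x] nx by (intro cINF_greatest) auto
  ultimately have "norm_gradient x \<phi>" using \<phi> by (simp add: norm_gradient_def)
  with that show ?thesis by blast
qed

lemma norm_gradient_abs_le: "norm_gradient x \<phi> \<Longrightarrow> \<bar>\<phi> v\<bar> \<le> norm v"
  by (auto simp: norm_gradient_def intro: linear_le_norm_abs)

text \<open>At a smooth \<open>x\<close> within distance less than 1 of \<open>sgn z\<close>, a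
  gradient killing \<open>z\<close> would take the value 1 on the short vector
  \<open>x - sgn z\<close>.\<close>

lemma norm_gradients_separate:
  fixes z :: "'x::real_normed_vector"
  assumes dense: "sphere (0::'x) 1 \<subseteq> closure smooth_points"
    and zero: "\<And>x \<phi>. x \<in> smooth_points \<Longrightarrow> norm_gradient x \<phi> \<Longrightarrow> \<phi> z = 0"
  shows "z = 0"
proof (rule ccontr)
  assume z: "z \<noteq> 0"
  then have "sgn z \<in> closure smooth_points" using dense by (auto simp: norm_sgn)
  then obtain x where x: "x \<in> smooth_points" "dist x (sgn z) < 1"
    by (metis closure_approachable zero_less_one)
  obtain \<phi> where \<phi>: "norm_gradient x \<phi>" using smooth_point_norm_gradient[OF x(1)] .
  then have lin: "linear \<phi>" and one: "\<phi> x = 1" by (auto simp: norm_gradient_def)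
  have "\<phi> (sgn z) = 0" using zero[OF x(1) \<phi>] lin by (simp add: sgn_div_norm linear_scale)
  then have "\<phi> (x - sgn z) = 1" using lin one by (simp add: linear_diff)
  then show False using norm_gradient_abs_le[OF \<phi>, of "x - sgn z"] x(2) by (simp add: dist_norm)
qed

section \<open>Isometries between unit spheres\<close>

text \<open>If \<open>a \<le> b\<close>, subtracting \<open>(b - a) *\<^sub>R f\<close> from
  \<open>b *\<^sub>R (f + g)\<close> leaves norm at least \<open>2 * b - (b - a) = 1\<close>; the
  other case is symmetric.\<close>

lemma norm_segment_eq_1:
  fixes f g :: "'a::real_normed_vector"
  assumes "norm f = 1" "norm g = 1" "norm (f + g) = 2" and ab: "a \<ge> 0" "b \<ge> 0" "a + b = 1"
  shows "norm (a *\<^sub>R f + b *\<^sub>R g) = 1"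
proof -
  have *: "norm (a *\<^sub>R f + b *\<^sub>R g) \<ge> 1"
    if "norm f = 1" "norm (f + g) = 2" "a \<le> b" "b \<ge> 0" "a + b = 1" for f g :: 'a and a b :: real
  proof -
    have eq: "a *\<^sub>R f + b *\<^sub>R g = b *\<^sub>R (f + g) - (b - a) *\<^sub>R f" by (simp add: algebra_simps)
    have "norm (b *\<^sub>R (f + g)) - norm ((b - a) *\<^sub>R f) \<le> norm (a *\<^sub>R f + b *\<^sub>R g)"
      unfolding eq by (rule norm_triangle_ineq2)
    then show ?thesis using that by simp
  qed
  have "norm (a *\<^sub>R f + b *\<^sub>R g) \<ge> 1"
    using *[of f g a b] *[of g f b a] assms by (cases "a \<le> b") (auto simp: add.commute)
  moreover have "norm (a *\<^sub>R f + b *\<^sub>R g) \<le> 1"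
    using norm_triangle_ineq[of "a *\<^sub>R f" "b *\<^sub>R g"] assms by simp
  ultimately show ?thesis by simp
qed

text \<open>The point \<open>z\<close> with \<open>T z = - T w\<close> is diametrally opposite to an inner point
  \<open>w\<close> of the segment from \<open>f\<close> to \<open>g\<close>, hence to \<open>f\<close>; let \<open>w\<close> tend to \<open>g\<close>.\<close>

lemma sphere_isometry_norm_add:
  fixes T :: "'a::real_normed_vector \<Rightarrow> 'b::real_normed_vector"
  assumes V: "subspace V" and f: "f \<in> V" "norm f = 1" and g: "g \<in> V" "norm g = 1"
    and fg: "norm (f + g) = 2"
    and iso: "\<And>f g. f \<in> V \<Longrightarrow> norm f = 1 \<Longrightarrow> g \<in> V \<Longrightarrow> norm g = 1 \<Longrightarrow> norm (T f - T g) = norm (f - g)"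
    and norm_T: "\<And>f. f \<in> V \<Longrightarrow> norm f = 1 \<Longrightarrow> norm (T f) = 1"
    and neg: "\<And>f. f \<in> V \<Longrightarrow> norm f = 1 \<Longrightarrow> \<exists>z\<in>V. norm z = 1 \<and> T z = - T f"
  shows "norm (T f + T g) = 2"
proof (rule antisym)
  show "norm (T f + T g) \<le> 2"
    using norm_triangle_ineq[of "T f" "T g"] norm_T[OF f] norm_T[OF g] by simp
  have *: "2 \<le> norm (T f + T g) + e" if e: "0 < e" for e
  proof -
    \<comment> \<open>The bound 1/2 keeps \<open>1 - a\<close> positive;
      \<open>2 * a \<le> e\<close> controls the distance from \<open>w\<close> to
      \<open>g\<close>.\<close>
    define a where "a = min (1/2) (e / 2)"
    have a: "0 < a" "a < 1" "2 * a \<le> e" using e by (auto simp: a_def min_def)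
    define w where "w = a *\<^sub>R f + (1 - a) *\<^sub>R g"
    have w: "w \<in> V" "norm w = 1"
      using f g a fg V unfolding w_def
      by (auto intro!: subspace_add subspace_scale norm_segment_eq_1)
    obtain z where z: "z \<in> V" "norm z = 1" "T z = - T w" using neg[OF w] by blast
    have tri: "norm (f - z) \<le> 2" "norm (g - z) \<le> 2"
      using norm_triangle_ineq4[of f z] norm_triangle_ineq4[of g z] f g z by auto
    have "2 = norm (T w - T z)" using norm_T[OF w] z(3) by (simp flip: scaleR_2)
    also have "\<dots> = norm (w - z)" using iso[OF w z(1,2)] .
    also have "w - z = a *\<^sub>R (f - z) + (1 - a) *\<^sub>R (g - z)" by (simp add: w_def algebra_simps)
    also have "norm \<dots> \<le> a * norm (f - z) + (1 - a) * norm (g - z)"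
      using norm_triangle_ineq[of "a *\<^sub>R (f - z)" "(1 - a) *\<^sub>R (g - z)"] a by simp
    also have "\<dots> \<le> a * norm (f - z) + (1 - a) * 2"
      using tri a by (intro add_left_mono mult_left_mono) auto
    finally have "a * 2 \<le> a * norm (f - z)" by (simp add: algebra_simps)
    then have "2 \<le> norm (f - z)" using a by simp
    also have "\<dots> = norm (T f - T z)" using iso[OF f z(1,2)] by simp
    also have "\<dots> \<le> norm (T f + T g) + norm (T w - T g)"
      using norm_triangle_ineq[of "T f + T g" "T w - T g"] z(3) by simp
    also have "norm (T w - T g) = norm (a *\<^sub>R (f - g))"
      using iso[OF w g] by (simp add: w_def algebra_simps)
    also have "\<dots> \<le> e"
    proof -
      have "norm (f - g) \<le> 2" using norm_triangle_ineq4[of f g] f g by simp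
      then have "a * norm (f - g) \<le> a * 2" using a by (intro mult_left_mono) auto
      then have "a * norm (f - g) \<le> e" using a(3) by linarith
      then show ?thesis using a(1) by simp
    qed
    finally show ?thesis by simp
  qed
  then show "2 \<le> norm (T f + T g)" by (rule field_le_epsilon)
qed

section \<open>Strictly convex spaces\<close>

text \<open>After division by \<open>r\<close> the midpoint lies on the unit sphere, hence is
  extreme and cannot be inside a proper segment of the ball. If \<open>r \<le> 0\<close>, both
  vectors vanish.\<close>

lemma strictly_convex_eqI:
  fixes a b :: "'x::real_normed_vector"
  assumes sc: "strictly_convex_space TYPE('x)"
    and "norm a \<le> r" "norm b \<le> r" "norm (a + b) = 2 * r"
  shows "a = b"
proof (cases "r > 0")
  case False
  then have "norm a = 0" "norm b = 0" using assms(2,3) norm_ge_zero[of a] norm_ge_zero[of b] by linarith+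
  then show ?thesis by simp
next
  case r: True
  let ?a = "a /\<^sub>R r" and ?b = "b /\<^sub>R r"
  have ab: "?a \<in> cball 0 1" "?b \<in> cball 0 1" using assms r by (auto simp: field_simps)
  have "midpoint ?a ?b = (inverse (2 * r)) *\<^sub>R (a + b)" by (simp add: midpoint_def algebra_simps)
  then have "norm (midpoint ?a ?b) = 1" using assms(4) r by simp
  then have "midpoint ?a ?b extreme_point_of cball 0 1"
    using sc by (auto simp: strictly_convex_space_def)
  then have "midpoint ?a ?b \<notin> open_segment ?a ?b" using ab unfolding extreme_point_of_def by blast
  then have "?a = ?b" by simp
  then show ?thesis using r by simp
qed

text \<open>The vectors \<open>k\<close> and \<open>m - k\<close> have norm at most half that of
  their sum \<open>m\<close>, so they coincide: metric midpoints are unique.\<close>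

lemma strictly_convex_midpoint_0:
  fixes k m :: "'x::real_normed_vector"
  assumes "strictly_convex_space TYPE('x)" "norm k \<le> norm m / 2" "norm (k - m) \<le> norm m / 2"
  shows "k = m /\<^sub>R 2"
proof -
  have "k = m - k"
    using assms by (intro strictly_convex_eqI[of k "norm m / 2" "m - k"]) (auto simp: norm_minus_commute)
  then have "2 *\<^sub>R k = m" by (simp add: scaleR_2 eq_diff_eq)
  then show ?thesis by auto
qed

section \<open>Continuous functions vanishing at infinity\<close>

text \<open>The component of \<open>t\<close> is a singleton, so Wilder's theorem separates it by a
  clopen set inside any neighbourhood. Taken inside a compact set, that clopen set is
  compact.\<close>

lemma compact_open_neighbourhood:
  fixes t :: "'k::t2_space"
  assumes td: "totally_disconnected_space TYPE('k)"
    and lc: "locally_compact_space (euclidean :: 'k topology)"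
    and V: "open V" "t \<in> V"
  obtains U where "open U" "compact U" "t \<in> U" "U \<subseteq> V"
proof -
  obtain N L where N: "open N" "compact L" "t \<in> N" "N \<subseteq> L"
    using lc unfolding locally_compact_space_def by (auto dest!: spec[of _ t])
  have "connected_component_of_set euclidean t = {t}"
  proof -
    have "connected (connected_component_of_set euclidean t)"
      using connectedin_connected_component_of[of euclidean t] by simp
    then obtain a where "connected_component_of_set euclidean t \<subseteq> {a}"
      using td unfolding totally_disconnected_space_def by blast
    moreover have "connected_component_of euclidean t t" by (simp add: connected_component_of_refl)
    ultimately show ?thesis by blast
  qed
  then have C: "{t} \<in> connected_components_of euclidean"
    by (metis UNIV_I connected_component_in_connected_components_of topspace_euclidean)
  have "Hausdorff_space (euclidean :: 'k topology)"
    by (metis Hausdorff_space_def disjnt_def hausdorff open_openin)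
  then obtain U W where U: "open U" "open W" "disjnt U W" "U \<union> W = UNIV" "{t} \<subseteq> U" "U \<subseteq> V \<inter> N"
    using wilder_locally_compact_component_thm[OF lc _ C, of "V \<inter> N"] V N by auto
  then have "U = L \<inter> - W" using N by (auto simp: disjnt_def)
  then have "compact U" using compact_Int_closed[OF N(2), of "- W"] U(2) by (simp add: closed_Compl)
  with U that show ?thesis by auto
qed

text \<open>The type of bounded continuous functions already carries the sup norm and vector
  operations, so $C_0(K,X)$ is treated as a subspace of it.\<close>

definition C0_bcontfun :: "('k::topological_space \<Rightarrow>\<^sub>C 'x::real_normed_vector) set" where
  "C0_bcontfun = {f. apply_bcontfun f \<in> C0}"

lemma C0_bcontfunI:
  assumes "\<And>e. e > 0 \<Longrightarrow> \<exists>C. compact C \<and> (\<forall>t. t \<notin> C \<longrightarrow> norm (apply_bcontfun f t) < e)"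
  shows "f \<in> C0_bcontfun"
  using assms by (auto simp: C0_bcontfun_def C0_def)

lemma C0_bcontfunE:
  assumes "f \<in> C0_bcontfun" "e > 0"
  obtains C where "compact C" "\<And>t. t \<notin> C \<Longrightarrow> norm (apply_bcontfun f t) < e"
  using assms by (auto simp: C0_bcontfun_def C0_def)

lemma subspace_C0_bcontfun: "subspace C0_bcontfun"
  unfolding subspace_def
proof (intro conjI ballI allI)
  show "0 \<in> C0_bcontfun" by (rule C0_bcontfunI) auto
next
  fix f g :: "'a \<Rightarrow>\<^sub>C 'b" assume fg: "f \<in> C0_bcontfun" "g \<in> C0_bcontfun"
  show "f + g \<in> C0_bcontfun"
  proof (rule C0_bcontfunI)
    fix e :: real assume "e > 0"
    then have e: "e / 2 > 0" by simp
    obtain C where C: "compact C" "\<And>t. t \<notin> C \<Longrightarrow> norm (f t) < e / 2"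
      using C0_bcontfunE[OF fg(1) e] by blast
    obtain D where D: "compact D" "\<And>t. t \<notin> D \<Longrightarrow> norm (g t) < e / 2"
      using C0_bcontfunE[OF fg(2) e] by blast
    have "norm ((f + g) t) < e" if "t \<notin> C \<union> D" for t
      using C(2)[of t] D(2)[of t] that norm_triangle_ineq[of "f t" "g t"] by simp
    then show "\<exists>C. compact C \<and> (\<forall>t. t \<notin> C \<longrightarrow> norm ((f + g) t) < e)"
      using compact_Un[OF C(1) D(1)] by blast
  qed
next
  fix c :: real and f :: "'a \<Rightarrow>\<^sub>C 'b" assume f: "f \<in> C0_bcontfun"
  show "c *\<^sub>R f \<in> C0_bcontfun"
  proof (rule C0_bcontfunI)
    fix e :: real assume e: "e > 0"
    then have "e / (\<bar>c\<bar> + 1) > 0" by simp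
    then obtain C where C: "compact C" "\<And>t. t \<notin> C \<Longrightarrow> norm (f t) < e / (\<bar>c\<bar> + 1)"
      using C0_bcontfunE[OF f] by blast
    have "norm ((c *\<^sub>R f) t) < e" if "t \<notin> C" for t
    proof -
      have "norm ((c *\<^sub>R f) t) \<le> (\<bar>c\<bar> + 1) * norm (f t)" by (simp add: mult_right_mono)
      also have "\<dots> < e" using C(2)[OF that] by (simp add: field_simps)
      finally show ?thesis .
    qed
    then show "\<exists>C. compact C \<and> (\<forall>t. t \<notin> C \<longrightarrow> norm ((c *\<^sub>R f) t) < e)" using C(1) by blast
  qed
qed

text \<open>Outside a compact set the values stay below half the norm; on that set a maximum is
  attained.\<close>

lemma C0_bcontfun_attains_norm:
  assumes f: "f \<in> C0_bcontfun" "f \<noteq> 0"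
  obtains t where "norm (apply_bcontfun f t) = norm f"
proof -
  have nf: "norm f > 0" using f(2) by simp
  then have "norm f / 2 > 0" by simp
  then obtain C where C: "compact C" "\<And>t. t \<notin> C \<Longrightarrow> norm (f t) < norm f / 2"
    using C0_bcontfunE[OF f(1)] by blast
  have "C \<noteq> {}"
  proof
    assume "C = {}"
    then have "norm f \<le> norm f / 2" using C(2) by (intro norm_bound) (auto intro: less_imp_le)
    then show False using nf by simp
  qed
  moreover have "continuous_on C (\<lambda>t. norm (f t))" by (intro continuous_intros continuous_on_apply_bcontfun)
  ultimately obtain s where s: "s \<in> C" "\<And>t. t \<in> C \<Longrightarrow> norm (f t) \<le> norm (f s)"
    using continuous_attains_sup[OF C(1)] by blast
  have "norm f \<le> max (norm f / 2) (norm (f s))"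
    using C(2) s(2) by (intro norm_bound) (force simp: le_max_iff_disj less_imp_le)
  then have "norm (f s) = norm f" using nf norm_bounded[of f s] by (auto simp: max_def split: if_splits)
  with that show ?thesis .
qed

section \<open>Functions changed to a constant on a compact open set\<close>

text \<open>Intended for compact open \<open>U\<close>: such a set is clopen, so no continuity is
  lost at its boundary.\<close>

definition patch :: "('k::topological_space \<Rightarrow>\<^sub>C 'x::real_normed_vector) \<Rightarrow> 'k set \<Rightarrow> 'x \<Rightarrow> 'k \<Rightarrow>\<^sub>C 'x" where
  "patch f U m = Bcontfun (\<lambda>t. if t \<in> U then m else apply_bcontfun f t)"

lemma patch_apply:
  fixes f :: "'k::t2_space \<Rightarrow>\<^sub>C 'x::real_normed_vector"
  assumes U: "open U" "compact U"
  shows "apply_bcontfun (patch f U m) t = (if t \<in> U then m else apply_bcontfun f t)"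
proof -
  have "continuous_on (U \<union> - U) (\<lambda>t. if t \<in> U then m else f t)"
    using U compact_imp_closed[OF U(2)]
    by (intro continuous_on_cases) (auto simp: closed_Compl)
  moreover have "norm (if t \<in> U then m else f t) \<le> max (norm m) (norm f)" for t
    using norm_bounded[of f t] by (simp add: le_max_iff_disj)
  ultimately have "(\<lambda>t. if t \<in> U then m else f t) \<in> bcontfun"
    by (intro bcontfun_normI[where b = "max (norm m) (norm f)"]) simp_all
  then show ?thesis by (simp add: patch_def Bcontfun_inverse)
qed

lemma patch_in_C0_bcontfun:
  fixes f :: "'k::t2_space \<Rightarrow>\<^sub>C 'x::real_normed_vector"
  assumes f: "f \<in> C0_bcontfun" and U: "open U" "compact U"
  shows "patch f U m \<in> C0_bcontfun"
proof (rule C0_bcontfunI)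
  fix e :: real assume "e > 0"
  then obtain C where C: "compact C" "\<And>t. t \<notin> C \<Longrightarrow> norm (f t) < e"
    using C0_bcontfunE[OF f] by blast
  then show "\<exists>C. compact C \<and> (\<forall>t. t \<notin> C \<longrightarrow> norm (patch f U m t) < e)"
    using U by (intro exI[of _ "C \<union> U"]) (auto simp: patch_apply compact_Un)
qed

lemma norm_bcontfun_eq_supnorm: "norm f = supnorm (apply_bcontfun f)"
  by (simp add: norm_bcontfun_def dist_bcontfun.rep_eq supnorm_def dist_norm)

text \<open>Compactness bounds \<open>f\<close> on \<open>C\<close>, and off \<open>C\<close> its
  norm is below 1, so \<open>f\<close> is bounded.\<close>

lemma C0_subset_range: "f \<in> C0 \<Longrightarrow> apply_bcontfun (Bcontfun f) = f"
proof -
  assume f: "f \<in> C0"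
  then have cont: "continuous_on UNIV f" by (simp add: C0_def)
  obtain C where C: "compact C" "\<And>t. t \<notin> C \<Longrightarrow> norm (f t) < 1"
    using f zero_less_one unfolding C0_def by blast
  have "bounded (f ` C)"
    using C(1) cont by (intro compact_imp_bounded compact_continuous_image) (auto intro: continuous_on_subset)
  then obtain b where b: "\<And>t. t \<in> C \<Longrightarrow> norm (f t) \<le> b" by (auto simp: bounded_iff)
  have "norm (f t) \<le> max b 1" for t
    using b[of t] C(2)[of t] by (cases "t \<in> C") auto
  with cont have "f \<in> bcontfun" by (rule bcontfun_normI)
  then show ?thesis by (rule Bcontfun_inverse)
qed

section \<open>Isometries from the unit sphere of $C_0(K,X)$\<close>

locale C0_sphere_isometry =
  fixes T :: "('k::t2_space \<Rightarrow>\<^sub>C 'x::real_normed_vector) \<Rightarrow> 'y::real_normed_vector" and S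
  assumes S_def: "S = {f \<in> C0_bcontfun. norm f = 1}"
    and strict_convex: "strictly_convex_space TYPE('x)"
    and totally_disconnected: "totally_disconnected_space TYPE('k)"
    and locally_compact: "locally_compact_space (euclidean :: 'k topology)"
    and isometry: "\<And>f g. f \<in> S \<Longrightarrow> g \<in> S \<Longrightarrow> norm (T f - T g) = norm (f - g)"
    and onto: "T ` S = sphere 0 1"
begin

lemma S_I: "f \<in> C0_bcontfun \<Longrightarrow> (\<And>t. norm (apply_bcontfun f t) \<le> 1) \<Longrightarrow> norm (apply_bcontfun f s) = 1 \<Longrightarrow> f \<in> S"
  using norm_bounded[of f s] norm_bound[of f 1] by (auto simp: S_def)

lemma S_norm: "f \<in> S \<Longrightarrow> norm f = 1"
  and S_C0: "f \<in> S \<Longrightarrow> f \<in> C0_bcontfun"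
  and S_le: "f \<in> S \<Longrightarrow> norm (apply_bcontfun f t) \<le> 1"
  using norm_bounded[of f t] by (auto simp: S_def)

lemma S_uminus: "f \<in> S \<Longrightarrow> - f \<in> S"
  using subspace_neg[OF subspace_C0_bcontfun] by (auto simp: S_def)

lemma norm_T: "f \<in> S \<Longrightarrow> norm (T f) = 1"
  using onto by auto

lemma T_surj:
  assumes "norm y = 1"
  obtains f where "f \<in> S" "T f = y"
proof -
  have "y \<in> T ` S" using assms onto by simp
  with that show ?thesis by blast
qed

lemma T_inj: "f \<in> S \<Longrightarrow> g \<in> S \<Longrightarrow> T f = T g \<Longrightarrow> f = g"
  using isometry[of f g] by simp

text \<open>The general lemma is applied to \<open>T\<close> and to its inverse \<open>R\<close>. It
  needs preimages of antipodes: for \<open>T\<close> by surjectivity, for \<open>R\<close> because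
  \<open>- R y\<close> lies in \<open>S\<close>.\<close>

lemma norm_T_add_eq_2:
  assumes f: "f \<in> S" and g: "g \<in> S"
  shows "norm (T f + T g) = 2 \<longleftrightarrow> norm (f + g) = 2"
proof
  assume "norm (f + g) = 2"
  then show "norm (T f + T g) = 2"
  proof (rule sphere_isometry_norm_add[OF subspace_C0_bcontfun, rotated 4])
    fix f :: "'k \<Rightarrow>\<^sub>C 'x" assume "f \<in> C0_bcontfun" "norm f = 1"
    then show "\<exists>z\<in>C0_bcontfun. norm z = 1 \<and> T z = - T f"
      using T_surj[of "- T f"] norm_T[of f] by (auto simp: S_def)
  qed (use f g isometry norm_T in \<open>auto simp: S_def\<close>)
next
  define R where "R = inv_into S T"
  have RT: "R (T h) = h" if "h \<in> S" for h
    unfolding R_def using that T_inj by (intro inv_into_f_f inj_onI) auto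
  have R: "R y \<in> S" "T (R y) = y" if "norm y = 1" for y
    using T_surj[OF that] RT by metis+
  assume "norm (T f + T g) = 2"
  then have "norm (R (T f) + R (T g)) = 2"
  proof (rule sphere_isometry_norm_add[OF subspace_UNIV, rotated 4])
    fix y z :: "'y" assume "norm y = 1" "norm z = 1"
    then show "norm (R y - R z) = norm (y - z)" using R isometry by metis
  next
    fix y :: "'y" assume y: "norm y = 1"
    then show "norm (R y) = 1" using R S_norm by blast
    have "R (T (- R y)) = - R y" using R[OF y] S_uminus RT by blast
    moreover have "norm (T (- R y)) = 1" using R[OF y] S_uminus norm_T by blast
    ultimately show "\<exists>z\<in>UNIV. norm z = 1 \<and> R z = - R y" by blast
  qed (use f g norm_T in auto)
  then show "norm (f + g) = 2" using RT f g by simp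
qed

lemma small_compact_open:
  fixes t :: 'k
  assumes "open V" "t \<in> V"
  obtains U where "open U" "compact U" "t \<in> U" "U \<subseteq> V"
  using compact_open_neighbourhood[OF totally_disconnected locally_compact assms] .

lemma open_near_value: "open {s. norm (apply_bcontfun f s - m) < e}"
  by (intro open_Collect_less continuous_intros continuous_on_apply_bcontfun)

lemma norm_diff_patch_le:
  fixes f :: "'k \<Rightarrow>\<^sub>C 'x"
  assumes "open U" "compact U" "e \<ge> 0" "\<And>s. s \<in> U \<Longrightarrow> norm (apply_bcontfun f s - m) \<le> e"
  shows "norm (f - patch f U m) \<le> e"
  using assms by (intro norm_bound) (auto simp: patch_apply)

text \<open>The disjunction names a point where norm one survives: off \<open>U\<close> it is
  inherited from \<open>f\<close>, inside \<open>U\<close> it comes from \<open>m\<close>.\<close>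

lemma patch_in_S:
  assumes f: "f \<in> S" and U: "open U" "compact U" and m: "norm m \<le> 1"
    and s: "s \<notin> U \<and> norm (apply_bcontfun f s) = 1 \<or> s \<in> U \<and> norm m = 1"
  shows "patch f U m \<in> S"
proof (rule S_I)
  show "patch f U m \<in> C0_bcontfun" using f U by (intro patch_in_C0_bcontfun S_C0)
  show "norm (patch f U m r) \<le> 1" for r using S_le[OF f] U m by (simp add: patch_apply)
  show "norm (patch f U m s) = 1" using U s by (auto simp: patch_apply)
qed

lemma patch_0_in_S:
  assumes U: "open U" "compact U" "t \<in> U" and x: "norm (x::'x) = 1"
  shows "patch 0 U x \<in> S"
proof (rule S_I)
  show "patch 0 U x \<in> C0_bcontfun"
    using U subspace_0[OF subspace_C0_bcontfun] by (intro patch_in_C0_bcontfun)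
  show "norm (patch 0 U x r) \<le> 1" for r using U x by (simp add: patch_apply)
  show "norm (patch 0 U x t) = 1" using U x by (simp add: patch_apply)
qed

lemma norm_add_eq_2I:
  assumes "f \<in> S" "k \<in> S" "apply_bcontfun f s = apply_bcontfun k s" "norm (apply_bcontfun f s) = 1"
  shows "norm (f + k) = 2"
  using norm_bounded[of "f + k" s] norm_triangle_ineq[of f k] assms S_norm by (simp flip: scaleR_2)

text \<open>The sum attains its norm at some point; strict convexity makes both functions agree
  there, and off \<open>U\<close> the values of \<open>f\<close> are too short.\<close>

lemma norm_add_eq_2D:
  assumes "f \<in> S" "k \<in> S" "norm (k + f) = 2"
    and "\<And>s. s \<in> U \<Longrightarrow> apply_bcontfun f s = x" "\<And>s. s \<notin> U \<Longrightarrow> norm (apply_bcontfun f s) < 1"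
  obtains s where "s \<in> U" "apply_bcontfun k s = x"
proof -
  have "k + f \<in> C0_bcontfun" using assms S_C0 subspace_add[OF subspace_C0_bcontfun] by blast
  then obtain s where s: "norm ((k + f) s) = 2"
    using C0_bcontfun_attains_norm assms(3) by (metis norm_zero zero_neq_numeral)
  then have "k s = f s"
    using assms S_le by (intro strictly_convex_eqI[OF strict_convex, of _ 1]) auto
  moreover have "s \<in> U"
    using s assms(5)[of s] S_le[OF assms(2), of s] norm_triangle_ineq[of "k s" "f s"] by force
  ultimately show ?thesis using that assms(4) by simp
qed

text \<open>Bumps with value \<open>x\<close> on small sets around \<open>t\<close> test for this
  value: otherwise \<open>k\<close> would avoid \<open>x\<close> on a whole neighbourhood, and the
  bump supported there would fail the test.\<close>

lemma value_detected:
  assumes k: "k \<in> S" and x: "norm x = 1"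
    and "\<And>U. open U \<Longrightarrow> compact U \<Longrightarrow> t \<in> U \<Longrightarrow> norm (k + patch 0 U x) = 2"
  shows "apply_bcontfun k t = x"
proof (rule ccontr)
  assume "k t \<noteq> x"
  moreover have "open {s. k s \<noteq> x}"
    by (intro open_Collect_neq continuous_intros continuous_on_apply_bcontfun)
  ultimately obtain U where U: "open U" "compact U" "t \<in> U" "U \<subseteq> {s. k s \<noteq> x}"
    using small_compact_open[of _ t] by blast
  obtain s where "s \<in> U" "k s = x"
    using norm_add_eq_2D[OF patch_0_in_S[OF U(1-3) x] k assms(3)[OF U(1-3)], of U x] U(1,2)
    by (auto simp: patch_apply)
  with U(4) show False by blast
qed

text \<open>A bump \<open>p\<close> shares the value \<open>x\<close> with \<open>f\<close>, so
  \<open>T p - T k = T p + T f\<close> has norm 2. By isometry \<open>p - k\<close> has norm 2 as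
  well, hence \<open>- k\<close> passes the test.\<close>

lemma antipode_value:
  assumes f: "f \<in> S" "apply_bcontfun f t = x" "norm x = 1" and k: "k \<in> S" "T k = - T f"
  shows "apply_bcontfun k t = - x"
proof -
  have "apply_bcontfun (- k) t = x"
  proof (rule value_detected)
    fix U assume U: "open U" "compact U" "t \<in> U"
    let ?p = "patch 0 U x"
    have p: "?p \<in> S" using patch_0_in_S[OF U f(3)] .
    have "norm (f + ?p) = 2"
      using f p U by (intro norm_add_eq_2I[of _ _ t]) (auto simp: patch_apply)
    then have "norm (T ?p - T k) = 2" using norm_T_add_eq_2[OF f(1) p] k(2) by (simp add: add.commute)
    then show "norm (- k + ?p) = 2" using isometry[OF p k(1)] by simp
  qed (use S_uminus k f in auto)
  then show ?thesis by (simp add: minus_equation_iff)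
qed

text \<open>The factor \<open>1 - e\<close> pushes the values off \<open>U\<close> strictly inside
  the ball at cost at most \<open>e\<close>; on \<open>U\<close> the change is below
  \<open>e\<close> by nearness.\<close>

lemma shrink_patch:
  assumes f: "f \<in> S" and x: "norm x = 1" and U: "open U" "compact U" "t \<in> U"
    and near: "\<forall>s\<in>U. norm (apply_bcontfun f s - x) < e" and e: "0 < e" "e < 1"
  defines "g \<equiv> patch ((1 - e) *\<^sub>R f) U x"
  shows "g \<in> S" "norm (f - g) \<le> e" "\<And>s. s \<in> U \<Longrightarrow> apply_bcontfun g s = x"
    "\<And>s. s \<notin> U \<Longrightarrow> norm (apply_bcontfun g s) < 1"
proof -
  have le: "(1 - e) * norm (f s) \<le> 1 - e" for s
    using e S_le[OF f, of s] by (simp add: mult_left_le)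
  show on: "\<And>s. s \<in> U \<Longrightarrow> g s = x" using U by (simp add: g_def patch_apply)
  show off: "norm (g s) < 1" if "s \<notin> U" for s
    using le_less_trans[OF le, of 1 s] U e that by (simp add: g_def patch_apply)
  have "g \<in> C0_bcontfun"
    unfolding g_def using U f S_C0 subspace_C0_bcontfun by (intro patch_in_C0_bcontfun subspace_scale) auto
  moreover have "norm (g s) \<le> 1" for s using on off x by (cases "s \<in> U") (auto intro: less_imp_le)
  moreover have "norm (g t) = 1" using on U x by simp
  ultimately show "g \<in> S" by (rule S_I)
  show "norm (f - g) \<le> e"
  proof (rule norm_bound)
    fix s
    have "f s - (1 - e) *\<^sub>R f s = e *\<^sub>R f s" by (simp add: algebra_simps)
    then show "norm ((f - g) s) \<le> e"
      using near S_le[OF f, of s] e U by (auto simp: g_def patch_apply intro: less_imp_le)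
  qed
qed

section \<open>Convexity of the images of faces\<close>

lemma convex_combination_in_sphere:
  assumes "f \<in> S" "apply_bcontfun f t = x" "g \<in> S" "apply_bcontfun g t = x" "norm x = 1"
    and "a \<ge> 0" "b \<ge> 0" "a + b = 1"
  obtains k where "k \<in> S" "T k = a *\<^sub>R T f + b *\<^sub>R T g"
proof -
  have "norm (f + g) = 2" using assms by (intro norm_add_eq_2I[of _ _ t]) auto
  then have "norm (a *\<^sub>R T f + b *\<^sub>R T g) = 1"
    using assms norm_T by (intro norm_segment_eq_1) (auto simp: norm_T_add_eq_2)
  from T_surj[OF this] that show ?thesis by blast
qed

text \<open>After a small perturbation, \<open>f\<close> and \<open>g\<close> equal \<open>x\<close> on a neighbourhood
  \<open>U'\<close> of \<open>t\<close> and have norm less than 1 elsewhere; then \<open>k\<close> takes the value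
  \<open>x\<close> somewhere in \<open>U'\<close>.\<close>

lemma convex_combination_value:
  assumes f: "f \<in> S" "apply_bcontfun f t = x" and g: "g \<in> S" "apply_bcontfun g t = x"
    and x: "norm x = 1" and ab: "a \<ge> 0" "b \<ge> 0" "a + b = 1"
    and k: "k \<in> S" "T k = a *\<^sub>R T f + b *\<^sub>R T g"
  shows "apply_bcontfun k t = x"
proof (rule value_detected[OF k(1) x])
  fix U assume U: "open U" "compact U" "t \<in> U"
  let ?p = "patch 0 U x"
  have p: "?p \<in> S" using patch_0_in_S[OF U x] .
  have "2 \<le> norm (k + ?p) + e" if "0 < e" "e < 1" for e
  proof -
    let ?V = "U \<inter> ({s. norm (f s - x) < e} \<inter> {s. norm (g s - x) < e})"
    have "open ?V" "t \<in> ?V"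
      using U f(2) g(2) that by (auto intro!: open_Int open_near_value)
    then obtain U' where U': "open U'" "compact U'" "t \<in> U'" "U' \<subseteq> ?V"
      using small_compact_open by blast
    define f' where "f' = patch ((1 - e) *\<^sub>R f) U' x"
    define g' where "g' = patch ((1 - e) *\<^sub>R g) U' x"
    have nf: "\<forall>s\<in>U'. norm (f s - x) < e" and ng: "\<forall>s\<in>U'. norm (g s - x) < e"
      using U'(4) by auto
    note f' = shrink_patch[OF f(1) x U'(1-3) nf that, folded f'_def]
    note g' = shrink_patch[OF g(1) x U'(1-3) ng that, folded g'_def]
    obtain k' where k': "k' \<in> S" "T k' = a *\<^sub>R T f' + b *\<^sub>R T g'"
      using convex_combination_in_sphere[OF f'(1) f'(3)[OF U'(3)] g'(1) g'(3)[OF U'(3)] x ab] .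
    have "norm (f' + g') = 2"
      using f' g' x U' by (intro norm_add_eq_2I[of _ _ t]) auto
    \<comment> \<open>These weights give the midpoint of \<open>T k'\<close> and
      \<open>T f'\<close>, which lies on the segment from \<open>T f'\<close> to
      \<open>T g'\<close>.\<close>
    then have "norm (((1 + a) / 2) *\<^sub>R T f' + (b / 2) *\<^sub>R T g') = 1"
      using f'(1) g'(1) norm_T ab by (intro norm_segment_eq_1) (auto simp: norm_T_add_eq_2 field_simps)
    moreover have "T k' + T f' = 2 *\<^sub>R (((1 + a) / 2) *\<^sub>R T f' + (b / 2) *\<^sub>R T g')"
    proof -
      have "2 * ((1 + a) / 2) = 1 + a" "2 * (b / 2) = b" by simp_all
      then show ?thesis
        by (simp only: k'(2) scaleR_add_right scaleR_scaleR) (simp add: scaleR_left_distrib)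
    qed
    ultimately have "norm (T k' + T f') = 2" by simp
    then have "norm (k' + f') = 2" using norm_T_add_eq_2[OF k'(1) f'(1)] by simp
    then obtain s where s: "s \<in> U'" "k' s = x"
      using norm_add_eq_2D[OF f'(1) k'(1) _ f'(3,4)] by blast
    then have "norm (k' + ?p) = 2"
      using U U' x k'(1) p by (intro norm_add_eq_2I[of _ _ s]) (auto simp: patch_apply)
    \<comment> \<open>Isometry carries the perturbation bound over to the preimages of the
      combinations.\<close>
    moreover have "norm (k' - k) \<le> e"
    proof -
      have "norm (k' - k) = norm (a *\<^sub>R (T f' - T f) + b *\<^sub>R (T g' - T g))"
        using isometry[OF k'(1) k(1)] by (simp add: k k' algebra_simps)
      also have "\<dots> \<le> a * norm (T f' - T f) + b * norm (T g' - T g)"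
        using norm_triangle_ineq[of "a *\<^sub>R (T f' - T f)" "b *\<^sub>R (T g' - T g)"] ab by simp
      also have "\<dots> \<le> a * e + b * e"
        using isometry[OF f'(1) f(1)] isometry[OF g'(1) g(1)] f'(2) g'(2) ab
        by (intro add_mono mult_left_mono) (auto simp: norm_minus_commute)
      also have "\<dots> = e" using ab by (simp flip: distrib_right)
      finally show ?thesis .
    qed
    ultimately show ?thesis
      using norm_triangle_ineq[of "k + ?p" "k' - k"] by (simp add: add.commute)
  qed
  then have "2 \<le> norm (k + ?p)"
    using dense_ge_bounded[of 0 1 "2 - norm (k + ?p)"] by force
  then show "norm (k + ?p) = 2"
    using norm_triangle_ineq[of k ?p] S_norm[OF k(1)] S_norm[OF p] by simp
qed

section \<open>Support functionals of the images of faces\<close>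

definition supports :: "'k \<Rightarrow> 'x \<Rightarrow> ('y \<Rightarrow> real) \<Rightarrow> bool" where
  "supports t x \<psi> \<longleftrightarrow> linear \<psi> \<and> (\<forall>y. \<psi> y \<le> norm y) \<and> (\<forall>f\<in>S. apply_bcontfun f t = x \<longrightarrow> \<psi> (T f) = 1)"

lemma ex_supports:
  assumes x: "norm x = 1"
  obtains \<psi> where "supports t x \<psi>"
proof -
  let ?F = "T ` {f \<in> S. f t = x}"
  have "convex ?F"
  proof (rule convexI)
    fix y z and a b :: real assume "y \<in> ?F" "z \<in> ?F" and ab: "0 \<le> a" "0 \<le> b" "a + b = 1"
    then obtain f g where f: "f \<in> S" "f t = x" "y = T f" and g: "g \<in> S" "g t = x" "z = T g"
      by blast
    obtain k where k: "k \<in> S" "T k = a *\<^sub>R T f + b *\<^sub>R T g"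
      using convex_combination_in_sphere[OF f(1,2) g(1,2) x ab] .
    moreover have "k t = x" using convex_combination_value[OF f(1,2) g(1,2) x ab k] .
    ultimately show "a *\<^sub>R y + b *\<^sub>R z \<in> ?F" using f(3) g(3) by (metis (mono_tags, lifting) image_eqI mem_Collect_eq)
  qed
  moreover have "?F \<subseteq> sphere 0 1" using norm_T by auto
  moreover have "?F \<noteq> {}"
  proof -
    obtain U where U: "open U" "compact U" "t \<in> U" by (rule small_compact_open[OF open_UNIV UNIV_I])
    have "patch 0 U x \<in> S" "patch 0 U x t = x"
      using patch_0_in_S[OF U x] U by (auto simp: patch_apply)
    then show ?thesis by blast
  qed
  ultimately obtain \<psi> :: "'y \<Rightarrow> real"
    where "linear \<psi>" "\<And>y. \<psi> y \<le> norm y" "\<And>y. y \<in> ?F \<Longrightarrow> \<psi> y = 1"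
    using support_functional_convex by blast
  then have "supports t x \<psi>" by (auto simp: supports_def)
  with that show ?thesis .
qed

lemma supports_lipschitz:
  assumes "supports t x \<psi>" "f \<in> S" "g \<in> S"
  shows "\<bar>\<psi> (T f) - \<psi> (T g)\<bar> \<le> norm (f - g)"
  using assms linear_le_norm_abs[of \<psi> "T f - T g"] isometry[of f g]
  by (simp add: supports_def linear_diff)

text \<open>The preimage of \<open>- T f\<close> takes the value \<open>x\<close> at
  \<open>t\<close>, so the functional is 1 on it.\<close>

lemma supports_neg:
  assumes \<psi>: "supports t x \<psi>" "norm x = 1" and f: "f \<in> S" "apply_bcontfun f t = - x"
  shows "\<psi> (T f) = - 1"
proof -
  obtain k where k: "k \<in> S" "T k = - T f" using T_surj[of "- T f"] norm_T[OF f(1)] by auto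
  then have "k t = x" using antipode_value[OF f _ k] \<psi>(2) by simp
  then have "\<psi> (- T f) = 1" using k \<psi>(1) by (force simp: supports_def)
  then show ?thesis using \<psi>(1) by (simp add: supports_def linear_neg)
qed

text \<open>Changing \<open>f\<close> to \<open>x\<close> or to \<open>- x\<close> on
  \<open>U\<close> moves it by at most the distance from \<open>m\<close>, and the functional is
  known to be 1 or -1 at the result.\<close>

lemma supports_bounds:
  assumes \<psi>: "supports t x \<psi>" "norm x = 1" and f: "f \<in> S"
    and U: "open U" "compact U" "t \<in> U" and m: "\<forall>s\<in>U. apply_bcontfun f s = m"
  shows "\<psi> (T f) \<le> norm (m + x) - 1" "1 - norm (m - x) \<le> \<psi> (T f)"
proof -
  have *: "patch f U y \<in> S" "patch f U y t = y" "norm (f - patch f U y) \<le> norm (m - y)"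
    if "norm y = 1" for y
    using that U m by (auto intro!: patch_in_S[OF f, of _ _ t] norm_diff_patch_le simp: patch_apply)
  note pos = *[OF \<psi>(2)]
  have "\<psi> (T (patch f U x)) = 1" using pos \<psi>(1) by (simp add: supports_def)
  then show "1 - norm (m - x) \<le> \<psi> (T f)"
    using supports_lipschitz[OF \<psi>(1) f pos(1)] pos(3) by simp
  have "norm (- x) = 1" using \<psi>(2) by simp
  note neg = *[OF this]
  have "\<psi> (T (patch f U (- x))) = - 1" using supports_neg[OF \<psi> neg(1,2)] .
  then show "\<psi> (T f) \<le> norm (m + x) - 1"
    using supports_lipschitz[OF \<psi>(1) f neg(1)] neg(3) by simp
qed

text \<open>The point \<open>s\<close> keeps \<open>f\<close> and its patch by 0 in one face, so the
  midpoint of their images has a preimage \<open>k\<close>. On \<open>U\<close>, \<open>k\<close>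
  lies within half the norm of \<open>m\<close> from both \<open>m\<close> and 0.\<close>

lemma supports_halve:
  assumes \<psi>: "supports t x \<psi>" "norm x = 1" and f: "f \<in> S" and s: "s \<notin> U" "norm (apply_bcontfun f s) = 1"
    and U: "open U" "compact U" "t \<in> U" and m: "\<forall>r\<in>U. apply_bcontfun f r = m"
  obtains k where "k \<in> S" "apply_bcontfun k s = apply_bcontfun f s" "\<psi> (T k) = \<psi> (T f) / 2"
    "\<forall>r\<in>U. apply_bcontfun k r = m /\<^sub>R 2"
proof -
  let ?e = "patch f U 0"
  have e: "?e \<in> S" "?e s = f s" "\<forall>r\<in>U. ?e r = 0" "norm (f - ?e) \<le> norm m"
    using U s m by (auto intro!: patch_in_S[OF f, of _ _ s] norm_diff_patch_le simp: patch_apply)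
  have half: "0 \<le> (1/2::real)" "1/2 + 1/2 = (1::real)" by auto
  obtain k where k: "k \<in> S" "T k = (1/2) *\<^sub>R T f + (1/2) *\<^sub>R T ?e"
    using convex_combination_in_sphere[OF f refl e(1,2) s(2) half(1,1,2)] .
  have ks: "k s = f s" using convex_combination_value[OF f refl e(1,2) s(2) half(1,1,2) k] .
  \<comment> \<open>For constant value 0 the upper and lower bounds are both 0.\<close>
  have "\<psi> (T ?e) = 0"
    using supports_bounds[OF \<psi> e(1) U e(3)] \<psi>(2) by simp
  then have "\<psi> (T k) = \<psi> (T f) / 2"
    using \<psi>(1) by (simp add: k(2) supports_def linear_add linear_scale)
  moreover have "k r = m /\<^sub>R 2" if r: "r \<in> U" for r
  proof -
    have "T k - T f = (1/2) *\<^sub>R (T ?e - T f)" "T k - T ?e = (1/2) *\<^sub>R (T f - T ?e)"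
      by (simp_all add: k(2) algebra_simps flip: scaleR_add_left)
    then have "norm (k - f) \<le> norm m / 2" "norm (k - ?e) \<le> norm m / 2"
      using isometry[OF k(1) f] isometry[OF k(1) e(1)] isometry[OF f e(1)] isometry[OF e(1) f] e(4)
      by (auto simp: norm_minus_commute)
    then show ?thesis
      using norm_bounded[of "k - f" r] norm_bounded[of "k - ?e" r] bspec[OF e(3) r] bspec[OF m r]
      by (intro strictly_convex_midpoint_0[OF strict_convex]) auto
  qed
  ultimately show ?thesis using that k(1) ks by blast
qed

lemma supports_halve_iterate:
  assumes \<psi>: "supports t x \<psi>" "norm x = 1" and f: "f \<in> S" and s: "s \<notin> U" "norm (apply_bcontfun f s) = 1"
    and U: "open U" "compact U" "t \<in> U" and m: "\<forall>r\<in>U. apply_bcontfun f r = m"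
  shows "\<exists>k\<in>S. apply_bcontfun k s = apply_bcontfun f s \<and> \<psi> (T k) = \<psi> (T f) / 2 ^ n \<and>
    (\<forall>r\<in>U. apply_bcontfun k r = m /\<^sub>R 2 ^ n)"
proof (induction n)
  case 0
  then show ?case using f m by auto
next
  case (Suc n)
  then obtain k where k: "k \<in> S" "k s = f s" "\<psi> (T k) = \<psi> (T f) / 2 ^ n" "\<forall>r\<in>U. k r = m /\<^sub>R 2 ^ n"
    by blast
  have ks: "norm (k s) = 1" using k(2) s(2) by simp
  then obtain k' where "k' \<in> S" "k' s = k s" "\<psi> (T k') = \<psi> (T k) / 2"
      "\<forall>r\<in>U. k' r = (m /\<^sub>R 2 ^ n) /\<^sub>R 2"
    using supports_halve[OF \<psi> k(1) s(1) ks U k(4)] by blast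
  with k show ?case by (intro bexI[of _ k']) auto
qed

text \<open>On functions constant near \<open>t\<close>, the two bounds for \<open>\<psi> \<circ> T\<close> agree to first order
  at 0; the halving trick rescales them to the value \<open>m\<close>.\<close>

lemma supports_eq_gradient_locally_constant:
  assumes \<psi>: "supports t x \<psi>" "norm x = 1" and \<phi>: "norm_gradient x \<phi>"
    and f: "f \<in> S" and s: "s \<notin> U" "norm (apply_bcontfun f s) = 1"
    and U: "open U" "compact U" "t \<in> U" and m: "\<forall>r\<in>U. apply_bcontfun f r = m"
  shows "\<psi> (T f) = \<phi> m"
proof -
  have lin: "linear \<phi>" using \<phi> by (simp add: norm_gradient_def)
  \<comment> \<open>Powers of 2 suffice as parameters, since
    \<open>norm (v + l *\<^sub>R x) - l\<close> decreases in \<open>l\<close>.\<close>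
  have grad: "c \<le> \<phi> v" if le: "\<And>n. c \<le> norm (v + 2 ^ n *\<^sub>R x) - 2 ^ n" for c v
  proof -
    have "c \<le> norm (v + l *\<^sub>R x) - l" if l: "l \<ge> 0" for l
    proof -
      obtain n where n: "l < 2 ^ n" using real_arch_pow[of 2 l] by auto
      have "norm (v + 2 ^ n *\<^sub>R x) = norm ((v + l *\<^sub>R x) + (2 ^ n - l) *\<^sub>R x)"
        by (simp add: algebra_simps)
      also have "\<dots> \<le> norm (v + l *\<^sub>R x) + norm ((2 ^ n - l) *\<^sub>R x)"
        by (rule norm_triangle_ineq)
      also have "norm ((2 ^ n - l) *\<^sub>R x) = 2 ^ n - l" using n \<psi>(2) by simp
      finally have "norm (v + 2 ^ n *\<^sub>R x) \<le> norm (v + l *\<^sub>R x) + (2 ^ n - l)" .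
      with le[of n] show ?thesis by linarith
    qed
    then show ?thesis using \<phi> by (auto simp: norm_gradient_def)
  qed
  \<comment> \<open>The bounds for the value \<open>m /\<^sub>R 2 ^ n\<close>, multiplied by
    \<open>2 ^ n\<close>.\<close>
  have bounds: "\<psi> (T f) \<le> norm (m + 2 ^ n *\<^sub>R x) - 2 ^ n" "- \<psi> (T f) \<le> norm (- m + 2 ^ n *\<^sub>R x) - 2 ^ n" for n
  proof -
    obtain k where k: "k \<in> S" "\<psi> (T k) = \<psi> (T f) / 2 ^ n" "\<forall>r\<in>U. k r = m /\<^sub>R 2 ^ n"
      using supports_halve_iterate[OF \<psi> f s U m, of n] by blast
    have eq: "2 ^ n * norm (m /\<^sub>R 2 ^ n + x) = norm (m + 2 ^ n *\<^sub>R x)"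
      "2 ^ n * norm (m /\<^sub>R 2 ^ n - x) = norm (- m + 2 ^ n *\<^sub>R x)"
    proof -
      have scale: "2 ^ n * norm v = norm (2 ^ n *\<^sub>R v)" for v :: 'x by simp
      have "2 ^ n *\<^sub>R (m /\<^sub>R 2 ^ n + x) = m + 2 ^ n *\<^sub>R x"
        "2 ^ n *\<^sub>R (m /\<^sub>R 2 ^ n - x) = - (- m + 2 ^ n *\<^sub>R x)"
        by (simp_all add: scaleR_add_right scaleR_diff_right)
      then show "2 ^ n * norm (m /\<^sub>R 2 ^ n + x) = norm (m + 2 ^ n *\<^sub>R x)"
        "2 ^ n * norm (m /\<^sub>R 2 ^ n - x) = norm (- m + 2 ^ n *\<^sub>R x)"
        unfolding scale by (simp_all only: norm_minus_cancel)
    qed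
    note b = supports_bounds[OF \<psi> k(1) U k(3)]
    have pos: "(0::real) \<le> 2 ^ n" by simp
    show "\<psi> (T f) \<le> norm (m + 2 ^ n *\<^sub>R x) - 2 ^ n"
      using mult_left_mono[OF b(1) pos] unfolding right_diff_distrib eq k(2) by simp
    show "- \<psi> (T f) \<le> norm (- m + 2 ^ n *\<^sub>R x) - 2 ^ n"
      using mult_left_mono[OF b(2) pos] unfolding right_diff_distrib eq k(2) by simp
  qed
  have "\<psi> (T f) \<le> \<phi> m" "- \<psi> (T f) \<le> \<phi> (- m)" using bounds by (intro grad; simp)+
  then show ?thesis using linear_neg[OF lin, of m] by simp
qed

end

text \<open>\<open>f\<close> is approximated by making it constant on a small neighbourhood of
  \<open>t\<close> that misses \<open>s\<close>, which preserves the point of norm one; both sides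
  vary continuously.\<close>

lemma (in C0_sphere_isometry) supports_eq_gradient_away:
  assumes \<psi>: "supports t x \<psi>" "norm x = 1" and \<phi>: "norm_gradient x \<phi>"
    and f: "f \<in> S" and s: "s \<noteq> t" "norm (apply_bcontfun f s) = 1"
  shows "\<psi> (T f) = \<phi> (apply_bcontfun f t)"
proof -
  let ?m = "f t"
  have "\<bar>\<psi> (T f) - \<phi> ?m\<bar> \<le> e" if "0 < e" for e
  proof -
    have "open ({r. norm (f r - ?m) < e} \<inter> - {s})" "t \<in> {r. norm (f r - ?m) < e} \<inter> - {s}"
      using s(1) that by (auto intro: open_Int open_near_value)
    then obtain U where U: "open U" "compact U" "t \<in> U" "U \<subseteq> {r. norm (f r - ?m) < e} \<inter> - {s}"
      using small_compact_open by blast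
    have sU: "s \<notin> U" using U(4) by blast
    let ?g = "patch f U ?m"
    have g: "?g \<in> S" using sU s(2) U S_le[OF f] by (intro patch_in_S[OF f, of _ _ s]) auto
    have "norm (?g s) = 1" "\<forall>r\<in>U. ?g r = ?m" using sU s(2) U by (auto simp: patch_apply)
    then have "\<psi> (T ?g) = \<phi> ?m"
      using supports_eq_gradient_locally_constant[OF \<psi> \<phi> g sU _ U(1-3)] by blast
    moreover have "norm (f - ?g) \<le> e" using U that by (intro norm_diff_patch_le) auto
    ultimately show ?thesis using supports_lipschitz[OF \<psi>(1) f g] by simp
  qed
  then have "\<bar>\<psi> (T f) - \<phi> ?m\<bar> \<le> 0" by (rule field_le_epsilon) simp
  then show ?thesis by simp
qed

section \<open>Affinity on faces and the unrestricted formula\<close>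

locale C0_sphere_isometry_smooth = C0_sphere_isometry T S
  for T :: "('k::t2_space \<Rightarrow>\<^sub>C 'x::real_normed_vector) \<Rightarrow> 'y::real_normed_vector" and S +
  assumes smooth_dense: "sphere (0::'x) 1 \<subseteq> closure smooth_points"
    and two_points: "\<exists>a b::'k. a \<noteq> b"
begin

lemma smooth_supports:
  assumes "x \<in> smooth_points"
  obtains \<psi> where "supports t x \<psi>" "norm x = 1"
  using assms ex_supports[of x t] by (auto simp: smooth_points_def)

text \<open>A preimage \<open>k\<close> of the combination stays in the face, so at every
  \<open>r \<noteq> t\<close> the point \<open>t\<close> provides the norm-one value elsewhere; the
  gradient formula then determines \<open>k r\<close>.\<close>

lemma T_affine_on_face:
  assumes f: "f \<in> S" "apply_bcontfun f t = v" and g: "g \<in> S" "apply_bcontfun g t = v"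
    and v: "norm v = 1" and ab: "a \<ge> 0" "b \<ge> 0" "a + b = 1"
  shows "T (a *\<^sub>R f + b *\<^sub>R g) = a *\<^sub>R T f + b *\<^sub>R T g"
proof -
  obtain k where k: "k \<in> S" "T k = a *\<^sub>R T f + b *\<^sub>R T g"
    using convex_combination_in_sphere[OF f g v ab] .
  have kt: "k t = v" using convex_combination_value[OF f g v ab k] .
  have "k r = a *\<^sub>R f r + b *\<^sub>R g r" for r
  proof (cases "r = t")
    case True
    have "a *\<^sub>R v + b *\<^sub>R v = v" using ab by (simp flip: scaleR_add_left)
    then show ?thesis using True kt f g by simp
  next
    case False
    have "k r - (a *\<^sub>R f r + b *\<^sub>R g r) = 0"
    proof (rule norm_gradients_separate[OF smooth_dense])
      fix x :: 'x and \<phi> assume x: "x \<in> smooth_points" and \<phi>: "norm_gradient x \<phi>"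
      obtain \<psi> where \<psi>: "supports r x \<psi>" "norm x = 1" using smooth_supports[OF x] .
      note * = supports_eq_gradient_away[OF \<psi> \<phi> _ False[symmetric]]
      have "\<phi> (k r) = \<psi> (T k)" using *[OF k(1)] kt v by simp
      also have "\<dots> = a * \<psi> (T f) + b * \<psi> (T g)"
        using \<psi>(1) by (simp add: k(2) supports_def linear_add linear_scale)
      also have "\<dots> = a * \<phi> (f r) + b * \<phi> (g r)" using *[OF f(1)] *[OF g(1)] f g v by simp
      finally show "\<phi> (k r - (a *\<^sub>R f r + b *\<^sub>R g r)) = 0"
        using \<phi> by (simp add: norm_gradient_def linear_diff linear_add linear_scale)
    qed
    then show ?thesis by simp
  qed
  then have "k = a *\<^sub>R f + b *\<^sub>R g" by (intro bcontfun_eqI) simp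
  with k(2) show ?thesis by simp
qed

text \<open>At another point \<open>s\<close>, \<open>f s\<close> is a convex combination of unit
  vectors \<open>y\<close> and \<open>- y\<close>. Patching either near \<open>s\<close> gives
  functions covered by the previous formula; they share a face at \<open>t\<close>, where
  \<open>T\<close> is affine.\<close>

lemma supports_eq_gradient_at:
  assumes \<psi>: "supports t x \<psi>" "norm x = 1" and \<phi>: "norm_gradient x \<phi>"
    and f: "f \<in> S" and ft: "norm (apply_bcontfun f t) = 1"
  shows "\<psi> (T f) = \<phi> (apply_bcontfun f t)"
proof -
  obtain s where s: "s \<noteq> t" using two_points by metis
  obtain y c where y: "norm y = 1" "f s = c *\<^sub>R y" and c: "0 \<le> c" "c \<le> 1"
  proof (cases "f s = 0")
    case True
    \<comment> \<open>Any unit vector serves when \<open>f s\<close> is 0.\<close>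
    then show thesis using that[of "f t" 0] ft by simp
  next
    case False
    then show thesis
      using that[of "sgn (f s)" "norm (f s)"] S_le[OF f] by (simp add: norm_sgn sgn_div_norm)
  qed
  have "\<bar>\<psi> (T f) - \<phi> (f t)\<bar> \<le> e" if "0 < e" for e
  proof -
    have "open ({r. norm (f r - f s) < e} \<inter> - {t})" "s \<in> {r. norm (f r - f s) < e} \<inter> - {t}"
      using s that by (auto intro: open_Int open_near_value)
    then obtain W where W: "open W" "compact W" "s \<in> W" "W \<subseteq> {r. norm (f r - f s) < e} \<inter> - {t}"
      using small_compact_open by blast
    have t: "t \<notin> W" using W(4) by blast
    have in_S: "patch f W m \<in> S" if "norm m \<le> 1" for m
      using that t ft W by (intro patch_in_S[OF f, of _ _ t]) auto
    have at_t: "patch f W m t = f t" and at_s: "patch f W m s = m" for m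
      using t W by (auto simp: patch_apply)
    have ext: "\<psi> (T (patch f W m)) = \<phi> (f t)" if "norm m = 1" for m
      using supports_eq_gradient_away[OF \<psi> \<phi> in_S s] at_t at_s that by simp
    \<comment> \<open>The solution of \<open>a + b = 1\<close> and \<open>a - b = c\<close>.\<close>
    define a b where "a = (1 + c) / 2" and "b = (1 - c) / 2"
    have ab: "a \<ge> 0" "b \<ge> 0" "a + b = 1" and "a - b = c" using c by (auto simp: a_def b_def field_simps)
    let ?g = "patch f W (f s)"
    have "a *\<^sub>R y + b *\<^sub>R (- y) = f s" using \<open>a - b = c\<close> y(2) by (simp flip: scaleR_left_diff_distrib)
    moreover have "a *\<^sub>R z + b *\<^sub>R z = z" for z :: 'x using ab by (simp flip: scaleR_add_left)
    ultimately have "?g = a *\<^sub>R patch f W y + b *\<^sub>R patch f W (- y)"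
      using W by (intro bcontfun_eqI) (simp add: patch_apply)
    then have "T ?g = a *\<^sub>R T (patch f W y) + b *\<^sub>R T (patch f W (- y))"
      using T_affine_on_face[OF in_S at_t in_S at_t ft ab] y(1) by simp
    then have "\<psi> (T ?g) = a * \<phi> (f t) + b * \<phi> (f t)"
      using \<psi>(1) ext y(1) by (simp add: supports_def linear_add linear_scale)
    then have "\<psi> (T ?g) = \<phi> (f t)" using ab by (simp flip: distrib_right)
    moreover have "norm (f - ?g) \<le> e" using W that by (intro norm_diff_patch_le) auto
    ultimately show ?thesis
      using supports_lipschitz[OF \<psi>(1) f in_S] S_le[OF f, of s] by fastforce
  qed
  then have "\<bar>\<psi> (T f) - \<phi> (f t)\<bar> \<le> 0" by (rule field_le_epsilon) simp
  then show ?thesis by simp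
qed

lemma supports_eq_gradient:
  assumes \<psi>: "supports t x \<psi>" "norm x = 1" and \<phi>: "norm_gradient x \<phi>" and f: "f \<in> S"
  shows "\<psi> (T f) = \<phi> (apply_bcontfun f t)"
proof -
  obtain s where "norm (f s) = 1"
    using C0_bcontfun_attains_norm[OF S_C0[OF f]] S_norm[OF f] by (metis norm_zero zero_neq_one)
  then show ?thesis
    using supports_eq_gradient_at[OF \<psi> \<phi> f] supports_eq_gradient_away[OF \<psi> \<phi> f, of s] by metis
qed

section \<open>The homogeneous extension\<close>

text \<open>At 0 the factor \<open>norm f\<close> gives 0, whatever \<open>T\<close> is
  there.\<close>

definition ext where "ext f = norm f *\<^sub>R T (f /\<^sub>R norm f)"

lemma ext_eq: "f \<in> S \<Longrightarrow> ext f = T f"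
  by (simp add: ext_def S_norm)

lemma normalize_in_S: "f \<in> C0_bcontfun \<Longrightarrow> f \<noteq> 0 \<Longrightarrow> f /\<^sub>R norm f \<in> S"
  using subspace_scale[OF subspace_C0_bcontfun] by (auto simp: S_def)

lemma norm_ext: "f \<in> C0_bcontfun \<Longrightarrow> norm (ext f) = norm f"
  using norm_T[OF normalize_in_S] by (cases "f = 0") (auto simp: ext_def)

lemma ext_surj:
  obtains f where "f \<in> C0_bcontfun" "ext f = y"
proof (cases "y = 0")
  case True
  then show ?thesis
    using that[of 0] subspace_0[OF subspace_C0_bcontfun] by (simp add: ext_def)
next
  case False
  then obtain f where f: "f \<in> S" "T f = sgn y" using T_surj[of "sgn y"] by (auto simp: norm_sgn)
  have "ext (norm y *\<^sub>R f) = y"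
    using False f S_norm[OF f(1)] by (simp add: ext_def sgn_div_norm)
  then show ?thesis
    using that subspace_scale[OF subspace_C0_bcontfun] S_C0[OF f(1)] by blast
qed

lemma supports_ext:
  assumes \<psi>: "supports t x \<psi>" "norm x = 1" and \<phi>: "norm_gradient x \<phi>" and f: "f \<in> C0_bcontfun"
  shows "\<psi> (ext f) = \<phi> (apply_bcontfun f t)"
proof (cases "f = 0")
  case True
  then show ?thesis using \<psi>(1) \<phi> by (simp add: ext_def supports_def norm_gradient_def linear_0)
next
  case False
  then show ?thesis
    using supports_eq_gradient[OF \<psi> \<phi> normalize_in_S[OF f False]] \<psi>(1) \<phi>
    by (simp add: ext_def supports_def norm_gradient_def linear_scale)
qed

text \<open>A preimage \<open>k\<close> of the right-hand side satisfies the gradient formula at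
  every point, and gradients separate the values of \<open>k\<close> from any others.\<close>

lemma ext_linear_combination:
  assumes f: "f \<in> C0_bcontfun" and g: "g \<in> C0_bcontfun"
  shows "ext (a *\<^sub>R f + b *\<^sub>R g) = a *\<^sub>R ext f + b *\<^sub>R ext g"
proof -
  obtain k where k: "k \<in> C0_bcontfun" "ext k = a *\<^sub>R ext f + b *\<^sub>R ext g" by (rule ext_surj)
  have "k t - (a *\<^sub>R f t + b *\<^sub>R g t) = 0" for t
  proof (rule norm_gradients_separate[OF smooth_dense])
    fix x :: 'x and \<phi> assume x: "x \<in> smooth_points" and \<phi>: "norm_gradient x \<phi>"
    obtain \<psi> where \<psi>: "supports t x \<psi>" "norm x = 1" using smooth_supports[OF x] .
    note * = supports_ext[OF \<psi> \<phi>]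
    have "\<phi> (k t) = a * \<phi> (f t) + b * \<phi> (g t)"
      using \<psi>(1) *[OF k(1)] *[OF f] *[OF g] by (simp add: k(2) supports_def linear_add linear_scale)
    then show "\<phi> (k t - (a *\<^sub>R f t + b *\<^sub>R g t)) = 0"
      using \<phi> by (simp add: norm_gradient_def linear_diff linear_add linear_scale)
  qed
  then have "k = a *\<^sub>R f + b *\<^sub>R g" by (intro bcontfun_eqI) simp
  with k(2) show ?thesis by simp
qed

end

section \<open>Transfer to functions in \<open>C0\<close>\<close>

theorem theorem4p4:
  assumes "strictly_convex_space TYPE('x::banach)"
    and "\<exists>u v::'x. u \<noteq> v \<and> independent {u, v}"
    and "sphere (0::'x) 1 \<subseteq> closure smooth_points"
    and "totally_disconnected_space TYPE('k::{t2_space})"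
    and "locally_compact_space (euclidean :: 'k topology)"
    and "\<exists>a b::'k. a \<noteq> b"
  shows "C0_MUP_wrt TYPE('k) TYPE('x) TYPE('y::banach)"
  unfolding C0_MUP_wrt_def
proof (intro allI impI, elim conjE)
  fix \<Delta> :: "('k \<Rightarrow> 'x) \<Rightarrow> 'y"
  assume iso: "\<forall>f\<in>C0_sphere. \<forall>g\<in>C0_sphere. norm (\<Delta> f - \<Delta> g) = supnorm (\<lambda>t. f t - g t)"
    and onto: "\<Delta> ` C0_sphere = sphere 0 1"
  define S :: "('k \<Rightarrow>\<^sub>C 'x) set" where "S = {f \<in> C0_bcontfun. norm f = 1}"
  have sphere: "apply_bcontfun f \<in> C0_sphere \<longleftrightarrow> f \<in> S" for f :: "'k \<Rightarrow>\<^sub>C 'x"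
    by (simp add: S_def C0_sphere_def C0_bcontfun_def norm_bcontfun_eq_supnorm)
  have diff: "supnorm (\<lambda>t. f t - g t) = norm (f - g)" for f g :: "'k \<Rightarrow>\<^sub>C 'x"
    by (simp add: norm_bcontfun_eq_supnorm)
  have C0: "Bcontfun f \<in> C0_bcontfun" "apply_bcontfun (Bcontfun f) = f" if "f \<in> C0" for f :: "'k \<Rightarrow> 'x"
    using that by (auto simp: C0_bcontfun_def C0_subset_range)
  have C0_sphere: "C0_sphere = apply_bcontfun ` S"
  proof (intro equalityI subsetI)
    fix f :: "'k \<Rightarrow> 'x" assume f: "f \<in> C0_sphere"
    then have "apply_bcontfun (Bcontfun f) = f" using C0(2) by (simp add: C0_sphere_def)
    then show "f \<in> apply_bcontfun ` S" using f sphere by (metis image_eqI)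
  qed (use sphere in auto)
  interpret C0_sphere_isometry_smooth "\<lambda>f. \<Delta> (apply_bcontfun f)" S
  proof
    show "(\<lambda>f. \<Delta> (apply_bcontfun f)) ` S = sphere 0 1"
      using onto by (simp add: C0_sphere image_image)
    show "norm (\<Delta> (apply_bcontfun f) - \<Delta> (apply_bcontfun g)) = norm (f - g)" if "f \<in> S" "g \<in> S" for f g
      using iso that by (simp add: sphere flip: diff)
  qed (use assms in \<open>simp_all add: S_def\<close>)
  have comb: "Bcontfun (\<lambda>t. a *\<^sub>R f t + b *\<^sub>R g t) = a *\<^sub>R Bcontfun f + b *\<^sub>R Bcontfun g"
    if "f \<in> C0" "g \<in> C0" for a b and f g :: "'k \<Rightarrow> 'x"
  proof -
    have "(\<lambda>t. a *\<^sub>R f t + b *\<^sub>R g t) = apply_bcontfun (a *\<^sub>R Bcontfun f + b *\<^sub>R Bcontfun g)"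
      using that by (simp add: fun_eq_iff C0)
    then show ?thesis by (metis apply_bcontfun_inverse)
  qed
  define L where "L f = ext (Bcontfun f)" for f
  have L: "L (\<lambda>t. a *\<^sub>R f t + b *\<^sub>R g t) = a *\<^sub>R L f + b *\<^sub>R L g" if "f \<in> C0" "g \<in> C0" for a b f g
    using that by (simp add: L_def comb ext_linear_combination C0)
  show "\<exists>L. (\<forall>f\<in>C0. \<forall>g\<in>C0. L (\<lambda>t. f t + g t) = L f + L g) \<and>
      (\<forall>c. \<forall>f\<in>C0. L (\<lambda>t. c *\<^sub>R f t) = c *\<^sub>R L f) \<and>
      (\<forall>f\<in>C0. \<forall>g\<in>C0. norm (L f - L g) = supnorm (\<lambda>t. f t - g t)) \<and>
      L ` C0 = UNIV \<and> (\<forall>f\<in>C0_sphere. L f = \<Delta> f)"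
  proof (intro exI[of _ L] conjI ballI allI)
    fix f g :: "'k \<Rightarrow> 'x" and c :: real assume f: "f \<in> C0"
    show "L (\<lambda>t. c *\<^sub>R f t) = c *\<^sub>R L f" using L[OF f f, of c 0] by simp
    assume g: "g \<in> C0"
    show "L (\<lambda>t. f t + g t) = L f + L g" using L[OF f g, of 1 1] by simp
    \<comment> \<open>By linearity the distance formula reduces to preservation of the norm.\<close>
    have "L f - L g = ext (Bcontfun f - Bcontfun g)"
      using ext_linear_combination[OF C0(1)[OF f] C0(1)[OF g], of 1 "- 1"] by (simp add: L_def)
    then show "norm (L f - L g) = supnorm (\<lambda>t. f t - g t)"
      using norm_ext[OF subspace_diff[OF subspace_C0_bcontfun C0(1)[OF f] C0(1)[OF g]]] f g
      by (simp add: C0 flip: diff)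
  next
    show "L ` C0 = UNIV"
    proof (intro equalityI subsetI)
      fix y :: 'y
      obtain f where "f \<in> C0_bcontfun" "ext f = y" by (rule ext_surj)
      then have "apply_bcontfun f \<in> C0" "L (apply_bcontfun f) = y"
        by (auto simp: C0_bcontfun_def L_def apply_bcontfun_inverse)
      then show "y \<in> L ` C0" by blast
    qed simp
  next
    fix f :: "'k \<Rightarrow> 'x" assume "f \<in> C0_sphere"
    then obtain g where "g \<in> S" "f = apply_bcontfun g" by (auto simp: C0_sphere)
    then show "L f = \<Delta> f" using ext_eq by (simp add: L_def apply_bcontfun_inverse)
  qed
qed

end
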